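(* Let $F\in H^2(T_{\Gamma_1})$, let $\alpha=(\alpha_1,\dots,\alpha_n)$ be an $n$-tuple of non-negative integers, and let $\beta\in\partial\Gamma_1$. Then, with $z=x+iy\in T_{\Gamma_1}$, $$\lim_{y\in\Gamma_1,\ y\to\beta}\frac{|\langle F,\phi_{\alpha,z}\rangle|}{\|\phi_{\alpha,z}\|}=0$$ uniformly for $x\in\mathbb R^n$.
   Context: $\Gamma_1=\{y\in\mathbb R^n: y_1>0,\dots,y_n>0\}$, $T_{\Gamma_1}=\{x+iy: x\in\mathbb R^n,\ y\in\Gamma_1\}\subset\mathbb C^n$. $H^2(T_{\Gamma_1})$ is the space of holomorphic $F$ on $T_{\Gamma_1}$ with $\|F\|^2=\sup_{y\in\Gamma_1}\int_{\mathbb R^n}|F(x+iy)|^2dx<\infty$; it is a Hilbert space with inner product $\langle F,G\rangle=\int_{\mathbb R^n}F(\xi)\overline{G(\xi)}\,d\xi$, where $F(\xi)=\lim_{\eta\in\Gamma_1,\eta\to0}F(\xi+i\eta)$ is the $L^2$ boundary limit. Its reproducing kernel is $K_{\Gamma_1}(w,\overline z)=\prod_{k=1}^n\frac{-1}{2\pi i(w_k-\overline z_k)}$. For $z\in T_{\Gamma_1}$, $$\phi_{\alpha,z}(w)=\frac{\partial^{|\alpha|}K_{\Gamma_1}(w,\overline z)}{\partial\overline z_1^{\alpha_1}\cdots\partial\overline z_n^{\alpha_n}}=\Big(\frac{-1}{2\pi i}\Big)^n\prod_{j=1}^n\frac{\alpha_j!}{(w_j-\overline z_j)^{\alpha_j+1}}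 .$$ *)

theory Defs
  imports "HOL-Analysis.Analysis" "HOL-Complex_Analysis.Complex_Analysis"
begin

definition Gamma1 :: "(real ^ 'n) set" where
  "Gamma1 = {y. \<forall>k. 0 < y $ k}"

definition cpoint :: "real ^ 'n \<Rightarrow> real ^ 'n \<Rightarrow> complex ^ 'n" where
  "cpoint x y = (\<chi> k. Complex (x $ k) (y $ k))"

definition tube :: "(real ^ 'n) set \<Rightarrow> (complex ^ 'n) set" where
  "tube B = {cpoint x y |x y. y \<in> B}"

definition cnj_vec :: "complex ^ 'n \<Rightarrow> complex ^ 'n" where
  "cnj_vec z = (\<chi> k. cnj (z $ k))"

text \<open>Holomorphy in several variables on an open set: the real Frechet derivative
  exists at every point and is complex linear.\<close>

definition holomorphic_several :: "(complex ^ 'n \<Rightarrow> complex) \<Rightarrow> (complex ^ 'n) set \<Rightarrow> bool" where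
  "holomorphic_several F S \<longleftrightarrow>
     (\<forall>z\<in>S. \<exists>L. (F has_derivative L) (at z) \<and> (\<forall>c v. L (c *s v) = c * L v))"

text \<open>Elements of the Hardy space are represented by total functions; only their values on
  the tube enter into the notions below.\<close>

definition hardy_sqnorm :: "(complex ^ 'n \<Rightarrow> complex) \<Rightarrow> ennreal" where
  "hardy_sqnorm F = (SUP y\<in>Gamma1. \<integral>\<^sup>+ x. ennreal ((cmod (F (cpoint x y)))\<^sup>2) \<partial>lborel)"

definition hardy_space :: "(complex ^ 'n \<Rightarrow> complex) set" where
  "hardy_space = {F. holomorphic_several F (tube Gamma1) \<and> hardy_sqnorm F < \<infinity>}"

definition hardy_norm :: "(complex ^ 'n \<Rightarrow> complex) \<Rightarrow> real" where
  "hardy_norm F = sqrt (enn2real (hardy_sqnorm F))"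

definition is_boundary_value :: "(complex ^ 'n \<Rightarrow> complex) \<Rightarrow> (real ^ 'n \<Rightarrow> complex) \<Rightarrow> bool" where
  "is_boundary_value F f \<longleftrightarrow>
     f \<in> borel_measurable lborel \<and>
     (\<integral>\<^sup>+ x. ennreal ((cmod (f x))\<^sup>2) \<partial>lborel) < \<infinity> \<and>
     ((\<lambda>y. \<integral>\<^sup>+ x. ennreal ((cmod (F (cpoint x y) - f x))\<^sup>2) \<partial>lborel) \<longlongrightarrow> 0)
       (at 0 within Gamma1)"

text \<open>The boundary value is determined only up to a null set, hence the choice of a
  representative. The inner product below does not depend on it.\<close>

definition boundary_value :: "(complex ^ 'n \<Rightarrow> complex) \<Rightarrow> real ^ 'n \<Rightarrow> complex" where
  "boundary_value F = (SOME f. is_boundary_value F f)"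

definition hardy_inner :: "(complex ^ 'n \<Rightarrow> complex) \<Rightarrow> (complex ^ 'n \<Rightarrow> complex) \<Rightarrow> complex" where
  "hardy_inner F G = (LINT x|lborel. boundary_value F x * cnj (boundary_value G x))"

text \<open>The second argument \<open>u\<close> is the slot for the conjugated variable: the reproducing kernel
  at \<open>w, z\<close> is \<open>hardy_kernel w (cnj_vec z)\<close>. It is holomorphic in \<open>u\<close>, so that its derivatives
  with respect to the conjugate of \<open>z\<close> are ordinary complex derivatives in \<open>u\<close>.\<close>

definition hardy_kernel :: "complex ^ 'n \<Rightarrow> complex ^ 'n \<Rightarrow> complex" where
  "hardy_kernel w u = (\<Prod>k\<in>UNIV. - 1 / (2 * of_real pi * \<i> * (w $ k - u $ k)))"

definition partial_deriv :: "'n \<Rightarrow> (complex ^ 'n \<Rightarrow> complex) \<Rightarrow> complex ^ 'n \<Rightarrow> complex" where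
  "partial_deriv k f u = deriv (\<lambda>t. f (\<chi> j. if j = k then t else u $ j)) (u $ k)"

text \<open>The index type carries no order, so the partial derivatives are taken along an arbitrary
  enumeration of it; for the kernel the order is immaterial by \<open>phi_eq\<close> below.\<close>

definition multi_deriv :: "nat ^ 'n \<Rightarrow> (complex ^ 'n \<Rightarrow> complex) \<Rightarrow> complex ^ 'n \<Rightarrow> complex" where
  "multi_deriv \<alpha> f =
     foldr (\<lambda>k. partial_deriv k ^^ (\<alpha> $ k)) (SOME ks. distinct ks \<and> set ks = UNIV) f"

definition phi :: "nat ^ 'n \<Rightarrow> complex ^ 'n \<Rightarrow> complex ^ 'n \<Rightarrow> complex" where
  "phi \<alpha> z w = multi_deriv \<alpha> (hardy_kernel w) (cnj_vec z)"

lemma partial_deriv_kernel_aux: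
  fixes w u :: "complex ^ 'n" and m :: "'n \<Rightarrow> nat"
  assumes f: "\<And>u. (\<forall>j. w $ j \<noteq> u $ j) \<Longrightarrow>
      f u = C * (\<Prod>j\<in>UNIV. fact (m j) / (w $ j - u $ j) ^ (m j + 1))"
    and u: "\<forall>j. w $ j \<noteq> u $ j"
  shows "partial_deriv k f u =
    C * (\<Prod>j\<in>UNIV. fact ((m(k := Suc (m k))) j) / (w $ j - u $ j) ^ ((m(k := Suc (m k))) j + 1))"
proof -
  define P where "P = (\<Prod>j\<in>UNIV - {k}. fact (m j) / (w $ j - u $ j) ^ (m j + 1))"
  have ev: "\<forall>\<^sub>F t in nhds (u $ k). t \<noteq> w $ k"
    using u by (metis t1_space_nhds)
  have eq: "f (\<chi> j. if j = k then t else u $ j) = C * P * (fact (m k) / (w $ k - t) ^ (m k + 1))"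
    if "t \<noteq> w $ k" for t
  proof -
    have "\<forall>j. w $ j \<noteq> (\<chi> j. if j = k then t else u $ j) $ j" using u that by auto
    from f[OF this] show ?thesis
      by (subst (asm) prod.remove[of _ k]) (auto simp: P_def intro!: prod.cong)
  qed
  have "partial_deriv k f u = deriv (\<lambda>t. C * P * (fact (m k) / (w $ k - t) ^ (m k + 1))) (u $ k)"
    unfolding partial_deriv_def
    by (rule deriv_cong_ev) (use eq ev in \<open>auto elim: eventually_mono\<close>)
  also have "\<dots> = C * P * (fact (Suc (m k)) / (w $ k - u $ k) ^ (Suc (m k) + 1))"
  proof (rule DERIV_imp_deriv)
    have nz: "w $ k - u $ k \<noteq> 0" using u by auto
    show "((\<lambda>t. C * P * (fact (m k) / (w $ k - t) ^ (m k + 1))) has_field_derivative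
      C * P * (fact (Suc (m k)) / (w $ k - u $ k) ^ (Suc (m k) + 1))) (at (u $ k))"
    proof -
      define d where "d = w $ k - u $ k"
      have "((\<lambda>t. inverse ((w $ k - t) ^ Suc (m k))) has_field_derivative
          - (inverse (d ^ Suc (m k)) * (of_nat (Suc (m k)) * (d ^ m k * - 1)) * inverse (d ^ Suc (m k)))) (at (u $ k))"
        using nz unfolding d_def
        by (auto intro!: derivative_eq_intros simp del: power_Suc of_nat_Suc)
      moreover have "- (inverse (d ^ Suc (m k)) * (of_nat (Suc (m k)) * (d ^ m k * - 1)) * inverse (d ^ Suc (m k)))
          = of_nat (Suc (m k)) / d ^ (Suc (m k) + 1)"
        using nz unfolding d_def[symmetric] by (simp add: divide_simps del: of_nat_Suc)
      ultimately have "((\<lambda>t. inverse ((w $ k - t) ^ Suc (m k))) has_field_derivative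
          of_nat (Suc (m k)) / d ^ (Suc (m k) + 1)) (at (u $ k))"
        by simp
      from DERIV_cmult[OF this, of "C * P * fact (m k)"] show ?thesis
        by (simp add: d_def divide_inverse mult_ac del: power_Suc of_nat_Suc)
    qed
  qed
  also have "\<dots> = C * (\<Prod>j\<in>UNIV. fact ((m(k := Suc (m k))) j) / (w $ j - u $ j) ^ ((m(k := Suc (m k))) j + 1))"
    by (subst prod.remove[of UNIV k]) (auto simp: P_def intro!: prod.cong)
  finally show ?thesis .
qed

lemma partial_deriv_funpow_kernel_aux:
  fixes w u :: "complex ^ 'n" and m :: "'n \<Rightarrow> nat"
  assumes f: "\<And>u. (\<forall>j. w $ j \<noteq> u $ j) \<Longrightarrow>
      f u = C * (\<Prod>j\<in>UNIV. fact (m j) / (w $ j - u $ j) ^ (m j + 1))"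
    and u: "\<forall>j. w $ j \<noteq> u $ j"
  shows "(partial_deriv k ^^ a) f u =
    C * (\<Prod>j\<in>UNIV. fact ((m(k := m k + a)) j) / (w $ j - u $ j) ^ ((m(k := m k + a)) j + 1))"
  using u
proof (induction a arbitrary: u)
  case 0
  then show ?case using f[of u] by simp
next
  case (Suc a)
  show ?case
    using partial_deriv_kernel_aux[where m = "m(k := m k + a)" and k = k, OF Suc.IH Suc.prems] by simp
qed

lemma phi_eq:
  fixes w z :: "complex ^ 'n"
  assumes wz: "\<And>j. w $ j \<noteq> cnj (z $ j)"
  shows "phi \<alpha> z w = (- 1 / (2 * of_real pi * \<i>)) ^ CARD('n) *
    (\<Prod>j\<in>UNIV. fact (\<alpha> $ j) / (w $ j - cnj (z $ j)) ^ (\<alpha> $ j + 1))"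
proof -
  define C :: complex where "C = (- 1 / (2 * of_real pi * \<i>)) ^ CARD('n)"
  have step: "foldr (\<lambda>k. partial_deriv k ^^ (\<alpha> $ k)) ks (hardy_kernel w) u =
      C * (\<Prod>j\<in>UNIV. fact (if j \<in> set ks then \<alpha> $ j else 0) /
        (w $ j - u $ j) ^ ((if j \<in> set ks then \<alpha> $ j else 0) + 1))"
    if "distinct ks" "\<forall>j. w $ j \<noteq> u $ j" for ks u
    using that
  proof (induction ks arbitrary: u)
    case Nil
    have "hardy_kernel w u = (\<Prod>j\<in>UNIV. (- 1 / (2 * of_real pi * \<i>)) * (1 / (w $ j - u $ j)))"
      by (simp add: hardy_kernel_def)
    then show ?case by (simp only: prod.distrib) (simp add: C_def)
  next
    case (Cons k ks)
    let ?m = "\<lambda>j. if j \<in> set ks then \<alpha> $ j else 0"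
    have m: "?m(k := ?m k + \<alpha> $ k) = (\<lambda>j. if j \<in> set (k # ks) then \<alpha> $ j else 0)"
      using Cons.prems by auto
    have d: "distinct ks" using Cons.prems by simp
    show ?case
      using partial_deriv_funpow_kernel_aux[where m = ?m and k = k and a = "\<alpha> $ k", OF Cons.IH[OF d] Cons.prems(2)]
      unfolding m by simp
  qed
  have "\<exists>ks :: 'n list. distinct ks \<and> set ks = UNIV"
    using finite_distinct_list[of "UNIV :: 'n set"] by auto
  then have "distinct (SOME ks :: 'n list. distinct ks \<and> set ks = UNIV) \<and>
      set (SOME ks :: 'n list. distinct ks \<and> set ks = UNIV) = UNIV"
    by (rule someI_ex)
  then show ?thesis
    using step[of "SOME ks. distinct ks \<and> set ks = UNIV" "cnj_vec z"] wz
    by (simp add: phi_def multi_deriv_def C_def cnj_vec_def)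
qed

end

theory Submission
  imports Defs "HOL-Probability.Sinc_Integral"
begin

text \<open>Existence of the boundary value of \<open>F\<close>: by a contour shift, the inner product of the slices of
  \<open>F\<close> at heights \<open>y\<close> and \<open>y'\<close> depends only on \<open>y + y'\<close>. With \<open>N y\<close> the squared \<open>L\<^sup>2\<close> norm of the slice
  at \<open>y\<close>, the squared distance of two slices is therefore \<open>N y + N y' - 2 N ((y + y') / 2)\<close>. Hence \<open>N\<close> is
  midpoint convex; being bounded on the cone, it decreases in each coordinate, so it converges
  as \<open>y\<close> tends to \<open>0\<close> and the slices are Cauchy in \<open>L\<^sup>2\<close>.

  Decay: this part works for any \<open>f\<close> in \<open>L\<^sup>2\<close> in place of the boundary value of \<open>F\<close>. A boundary point
  \<open>\<beta>\<close> has a coordinate \<open>\<beta>\<^sub>k = 0\<close>. As \<open>y\<^sub>k\<close> tends to \<open>0\<close>, the normalised kernel concentrates by scaling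
  on a slab \<open>\<bar>\<xi>\<^sub>k - x\<^sub>k\<bar> < d\<close>, and \<open>f\<close> has uniformly small \<open>L\<^sup>2\<close> mass on thin slabs. The Cauchy-Schwarz
  inequality on the slab and on its complement gives the limit, uniformly in \<open>x\<close>.\<close>

subsection \<open>Existence of boundary values\<close>

lemma open_Gamma1: "open (Gamma1 :: (real ^ 'n) set)"
proof -
  have "open (\<Inter>k. {y :: real ^ 'n. 0 < y $ k})"
    by (intro open_INT ballI open_Collect_less continuous_intros) simp
  moreover have "(\<Inter>k. {y :: real ^ 'n. 0 < y $ k}) = Gamma1"
    by (auto simp: Gamma1_def)
  ultimately show ?thesis by simp
qed

lemma convex_Gamma1: "convex (Gamma1 :: (real ^ 'n) set)"
  unfolding convex_def Gamma1_def
  by (auto simp: add_nonneg_pos add_pos_nonneg) (metis add_pos_pos add_pos_nonneg le_less mult_pos_pos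
      mult_zero_left add_0 zero_less_one)

lemma cpoint_mem_tube: "cpoint x y \<in> tube B" if "y \<in> B"
  using that by (auto simp: tube_def)

lemma continuous_on_cpoint [continuous_intros]:
  fixes f g :: "'a::topological_space \<Rightarrow> real ^ 'n"
  assumes "continuous_on S f" "continuous_on S g"
  shows "continuous_on S (\<lambda>x. cpoint (f x) (g x))"
  unfolding cpoint_def Complex_eq
  by (intro continuous_on_vec_lambda continuous_intros assms)

lemma holomorphic_several_continuous_on:
  assumes "holomorphic_several F S"
  shows "continuous_on S F"
  using assms unfolding holomorphic_several_def
  by (meson continuous_at_imp_continuous_on has_derivative_continuous)

text \<open>The point at parameter \<open>\<zeta>\<close> is
  \<open>cpoint x y + \<zeta> *s v\<close>, where \<open>v\<close> is the real vector
  \<open>h\<close> read as a complex one. The chain rule therefore meets the derivative of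
  \<open>F\<close> only on complex multiples of \<open>v\<close>, and its complex linearity yields a
  complex derivative.\<close>

lemma holomorphic_on_complex_line:
  fixes F :: "complex ^ 'n \<Rightarrow> complex"
  assumes "holomorphic_several F (tube B)"
  shows "(\<lambda>\<zeta>. F (cpoint (x + Re \<zeta> *\<^sub>R h) (y + Im \<zeta> *\<^sub>R h))) holomorphic_on
    {\<zeta>. y + Im \<zeta> *\<^sub>R h \<in> B}"
proof -
  define v :: "complex ^ 'n" where "v = (\<chi> k. of_real (h $ k))"
  have eq: "cpoint (x + Re \<zeta> *\<^sub>R h) (y + Im \<zeta> *\<^sub>R h) = cpoint x y + \<zeta> *s v" for \<zeta>
    by (auto simp: cpoint_def v_def vec_eq_iff complex_eq_iff)
  have "linear (\<lambda>d. d *s v)"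
    by (rule linearI) (auto simp: vec_eq_iff algebra_simps)
  then have bl: "bounded_linear (\<lambda>d. d *s v)"
    by (rule linear_conv_bounded_linear[THEN iffD1])
  show ?thesis
    unfolding holomorphic_on_def
  proof
    fix \<zeta> assume "\<zeta> \<in> {\<zeta>. y + Im \<zeta> *\<^sub>R h \<in> B}"
    then have "cpoint x y + \<zeta> *s v \<in> tube B"
      unfolding eq[symmetric] by (auto intro: cpoint_mem_tube)
    then obtain L where L: "(F has_derivative L) (at (cpoint x y + \<zeta> *s v))"
      and lin: "\<And>c v. L (c *s v) = c * L v"
      using assms unfolding holomorphic_several_def by blast
    have "((\<lambda>\<zeta>. cpoint x y + \<zeta> *s v) has_derivative (\<lambda>d. d *s v)) (at \<zeta>)"
      by (auto intro!: derivative_eq_intros bounded_linear.has_derivative[OF bl])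
    from has_derivative_compose[OF this L]
    have "((\<lambda>\<zeta>. F (cpoint x y + \<zeta> *s v)) has_field_derivative L v) (at \<zeta>)"
      unfolding has_field_derivative_def lin mult.commute[of _ "L v"] .
    then show "(\<lambda>\<zeta>. F (cpoint (x + Re \<zeta> *\<^sub>R h) (y + Im \<zeta> *\<^sub>R h))) field_differentiable
        (at \<zeta> within {\<zeta>. y + Im \<zeta> *\<^sub>R h \<in> B})"
      unfolding eq field_differentiable_def by (meson has_field_derivative_at_within)
  qed
qed

text \<open>A holomorphic function on an open convex set has a primitive \<open>U\<close>. Along
  either pair of sides the integrals telescope to
  \<open>U (Complex 1 1) - U (Complex 0 0)\<close>.\<close>

lemma unit_square_Cauchy:
  fixes u :: "complex \<Rightarrow> complex"
  assumes hol: "u holomorphic_on S" and S: "open S" "convex S"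
    and sub: "\<And>\<zeta>. 0 \<le> Re \<zeta> \<Longrightarrow> Re \<zeta> \<le> 1 \<Longrightarrow> 0 \<le> Im \<zeta> \<Longrightarrow> Im \<zeta> \<le> 1 \<Longrightarrow> \<zeta> \<in> S"
  shows "(LINT s:{0..1}|lborel. u (Complex s 0)) + \<i> * (LINT t:{0..1}|lborel. u (Complex 1 t)) =
    (LINT s:{0..1}|lborel. u (Complex s 1)) + \<i> * (LINT t:{0..1}|lborel. u (Complex 0 t))"
proof -
  obtain U where U: "\<And>\<zeta>. \<zeta> \<in> S \<Longrightarrow> (U has_field_derivative u \<zeta>) (at \<zeta>)"
    using holomorphic_convex_primitive'[OF S(2,1) hol] at_within_open[OF _ S(1)] by metis
  have cont: "continuous_on S u"
    using hol by (rule holomorphic_on_imp_continuous_on)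
  have h: "(LINT s:{0..1}|lborel. u (Complex s c)) = U (Complex 1 c) - U (Complex 0 c)"
    if c: "0 \<le> c" "c \<le> 1" for c
    unfolding set_lebesgue_integral_def
  proof (rule integral_FTC_Icc[where F = "\<lambda>s. U (Complex s c)"])
    fix s :: real assume s: "0 \<le> s" "s \<le> 1"
    have "((\<lambda>s. Complex s c) has_vector_derivative 1) (at s within {0..1})"
      unfolding Complex_eq by (auto intro!: derivative_eq_intros simp: has_vector_derivative_def scaleR_conv_of_real)
    from field_vector_diff_chain_within[OF this, of U "u (Complex s c)"]
    show "((\<lambda>s. U (Complex s c)) has_vector_derivative u (Complex s c)) (at s within {0..1})"
      using U[of "Complex s c"] sub[of "Complex s c"] s c
      by (auto simp: o_def has_field_derivative_at_within)
  qed (use c sub in \<open>auto simp: Complex_eq intro!: continuous_on_compose2[OF cont] continuous_intros\<close>)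
  have v: "\<i> * (LINT t:{0..1}|lborel. u (Complex c t)) = U (Complex c 1) - U (Complex c 0)"
    if c: "0 \<le> c" "c \<le> 1" for c
  proof -
    have "\<i> * (LINT t:{0..1}|lborel. u (Complex c t)) = (LINT t:{0..1}|lborel. \<i> * u (Complex c t))"
      by simp
    also have "\<dots> = U (Complex c 1) - U (Complex c 0)"
      unfolding set_lebesgue_integral_def
    proof (rule integral_FTC_Icc[where F = "\<lambda>t. U (Complex c t)"])
      fix t :: real assume t: "0 \<le> t" "t \<le> 1"
      have "((\<lambda>t. Complex c t) has_vector_derivative \<i>) (at t within {0..1})"
        unfolding Complex_eq by (auto intro!: derivative_eq_intros simp: has_vector_derivative_def scaleR_conv_of_real)
      from field_vector_diff_chain_within[OF this, of U "u (Complex c t)"]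
      show "((\<lambda>t. U (Complex c t)) has_vector_derivative \<i> * u (Complex c t)) (at t within {0..1})"
        using U[of "Complex c t"] sub[of "Complex c t"] t c
        by (auto simp: o_def has_field_derivative_at_within)
    qed (use c sub in \<open>auto simp: Complex_eq intro!: continuous_on_compose2[OF cont] continuous_intros\<close>)
    finally show ?thesis .
  qed
  show ?thesis
    using h[of 0] h[of 1] v[of 0] v[of 1] by simp
qed

text \<open>Fubini on the slab: a bound \<open>C\<close> on the L1 norm of every slice, integrated
  over an interval of length 1, bounds the L1 norm on the product.\<close>

lemma
  fixes G :: "'a::euclidean_space \<Rightarrow> real \<Rightarrow> complex"
  assumes cont: "continuous_on (UNIV \<times> {0..1}) (\<lambda>p. G (fst p) (snd p))"
    and bd: "\<And>t. t \<in> {0..1} \<Longrightarrow> (\<integral>\<^sup>+ x. ennreal (cmod (G x t)) \<partial>lborel) \<le> ennreal C"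
  shows integrable_slab_average: "integrable lborel (\<lambda>x. LINT t:{0..1}|lborel. G x t)"
    and integral_slab_average:
      "(LINT x|lborel. (LINT t:{0..1}|lborel. G x t)) = (LINT t:{0..1}|lborel. (LINT x|lborel. G x t))"
proof -
  \<comment> \<open>Continuity is known on the closed slab only; extension by zero gives a function
    measurable on the whole product space.\<close>
  define g where "g x t = indicator {0..1} t *\<^sub>R G x t" for x and t :: real
  have "(\<lambda>p. indicator (UNIV \<times> {0..1}) p *\<^sub>R G (fst p) (snd p)) \<in> borel_measurable borel"
    using cont by (intro borel_measurable_continuous_on_indicator) (auto intro!: borel_closed closed_Times)
  then have [measurable]: "case_prod g \<in> borel_measurable (lborel \<Otimes>\<^sub>M lborel)"
    by (simp add: g_def case_prod_beta' lborel_prod indicator_times)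
  have "(\<integral>\<^sup>+ p. ennreal (norm (case_prod g p)) \<partial>(lborel \<Otimes>\<^sub>M lborel)) =
      (\<integral>\<^sup>+ t. (\<integral>\<^sup>+ x. ennreal (norm (g x t)) \<partial>lborel) \<partial>lborel)"
    by (subst lborel_pair.nn_integral_snd[symmetric]) auto
  also have "\<dots> \<le> (\<integral>\<^sup>+ t. ennreal C * indicator {0..1} (t::real) \<partial>lborel)"
  proof (rule nn_integral_mono)
    fix t :: real
    show "(\<integral>\<^sup>+ x. ennreal (norm (g x t)) \<partial>lborel) \<le> ennreal C * indicator {0..1} t"
      using bd[of t] by (cases "t \<in> {0..1}") (simp_all add: g_def)
  qed
  also have "\<dots> < \<infinity>" by (simp add: nn_integral_cmult)
  finally have int: "integrable (lborel \<Otimes>\<^sub>M lborel) (case_prod g)"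
    by (intro integrableI_bounded) auto
  show "integrable lborel (\<lambda>x. LINT t:{0..1}|lborel. G x t)"
    using lborel_pair.integrable_fst'[OF int] by (simp add: g_def set_lebesgue_integral_def)
  show "(LINT x|lborel. (LINT t:{0..1}|lborel. G x t)) = (LINT t:{0..1}|lborel. (LINT x|lborel. G x t))"
    using lborel_pair.Fubini_integral[OF int] by (simp add: g_def set_lebesgue_integral_def)
qed

text \<open>A concrete sequence of heights tending to 0 inside the cone. It reduces both existence
  and uniqueness of boundary values to limits of sequences.\<close>

lemma filterlim_Gamma1_zero:
  "filterlim (\<lambda>n. (\<chi> k. 1 / real (Suc n)) :: real ^ 'n) (at 0 within Gamma1) sequentially"
proof -
  have "(\<lambda>n. (\<chi> k. 1 / real (Suc n)) :: real ^ 'n) \<longlonglongrightarrow> 0"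
    by (rule vec_tendstoI) (use LIMSEQ_inverse_real_of_nat in \<open>simp add: inverse_eq_divide\<close>)
  then show ?thesis
    by (auto simp: filterlim_at Gamma1_def vec_eq_iff)
qed

text \<open>Working with squared norms throughout avoids square roots of \<open>ennreal\<close>
  integrals; the price is the factor 2, from
  \<open>2 * a * b \<le> a\<^sup>2 + b\<^sup>2\<close>.\<close>

lemma nn_integral_sqnorm_triangle:
  fixes f g h :: "'a \<Rightarrow> complex"
  assumes [measurable]: "f \<in> borel_measurable M" "g \<in> borel_measurable M" "h \<in> borel_measurable M"
  shows "(\<integral>\<^sup>+ x. ennreal ((cmod (f x - h x))\<^sup>2) \<partial>M) \<le>
    2 * (\<integral>\<^sup>+ x. ennreal ((cmod (f x - g x))\<^sup>2) \<partial>M) + 2 * (\<integral>\<^sup>+ x. ennreal ((cmod (g x - h x))\<^sup>2) \<partial>M)"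
proof -
  have sq: "(cmod (f x - h x))\<^sup>2 \<le> 2 * (cmod (f x - g x))\<^sup>2 + 2 * (cmod (g x - h x))\<^sup>2" for x
  proof -
    have "(cmod (f x - h x))\<^sup>2 \<le> (cmod (f x - g x) + cmod (g x - h x))\<^sup>2"
      by (intro power_mono norm_diff_triangle_le) auto
    also have "\<dots> \<le> 2 * (cmod (f x - g x))\<^sup>2 + 2 * (cmod (g x - h x))\<^sup>2"
      using sum_squares_bound[of "cmod (f x - g x)" "cmod (g x - h x)"] by (simp add: power2_sum)
    finally show ?thesis .
  qed
  have "ennreal ((cmod (f x - h x))\<^sup>2) \<le>
      2 * ennreal ((cmod (f x - g x))\<^sup>2) + 2 * ennreal ((cmod (g x - h x))\<^sup>2)" for x
  proof -
    have "ennreal ((cmod (f x - h x))\<^sup>2) \<le> ennreal (2 * (cmod (f x - g x))\<^sup>2 + 2 * (cmod (g x - h x))\<^sup>2)"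
      by (rule ennreal_leI[OF sq])
    then show ?thesis by (simp add: ennreal_mult)
  qed
  then have "(\<integral>\<^sup>+ x. ennreal ((cmod (f x - h x))\<^sup>2) \<partial>M) \<le>
      (\<integral>\<^sup>+ x. 2 * ennreal ((cmod (f x - g x))\<^sup>2) + 2 * ennreal ((cmod (g x - h x))\<^sup>2) \<partial>M)"
    by (rule nn_integral_mono)
  also have "\<dots> = 2 * (\<integral>\<^sup>+ x. ennreal ((cmod (f x - g x))\<^sup>2) \<partial>M) +
      2 * (\<integral>\<^sup>+ x. ennreal ((cmod (g x - h x))\<^sup>2) \<partial>M)"
    by (simp add: nn_integral_add nn_integral_cmult)
  finally show ?thesis .
qed

lemma borel_measurable_cnj [measurable (raw)]:
  assumes "f \<in> borel_measurable M"
  shows "(\<lambda>x. cnj (f x)) \<in> borel_measurable M"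
  by (rule borel_measurable_continuous_on[OF _ assms]) (intro continuous_intros)

lemma nn_integral_lborel_translate:
  fixes f :: "'a::euclidean_space \<Rightarrow> ennreal"
  assumes "f \<in> borel_measurable borel"
  shows "(\<integral>\<^sup>+ x. f (x + a) \<partial>lborel) = (\<integral>\<^sup>+ x. f x \<partial>lborel)"
  by (subst (2) lborel_distr_plus[of a, symmetric]) (simp add: nn_integral_distr assms add.commute)

lemma integral_lborel_translate:
  fixes f :: "'a::euclidean_space \<Rightarrow> complex"
  assumes "f \<in> borel_measurable borel"
  shows "(LINT x|lborel. f (x + a)) = (LINT x|lborel. f x)"
  by (subst (2) lborel_distr_plus[of a, symmetric]) (simp add: integral_distr assms add.commute)

lemma nn_integral_mult_cnj_le:
  fixes f g :: "'a \<Rightarrow> complex"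
  assumes [measurable]: "f \<in> borel_measurable M" "g \<in> borel_measurable M"
    and "(\<integral>\<^sup>+ x. ennreal ((cmod (f x))\<^sup>2) \<partial>M) \<le> ennreal C"
    and "(\<integral>\<^sup>+ x. ennreal ((cmod (g x))\<^sup>2) \<partial>M) \<le> ennreal C"
  shows "(\<integral>\<^sup>+ x. ennreal (cmod (f x * cnj (g x))) \<partial>M) \<le> ennreal C"
proof -
  have "2 * cmod (f x * cnj (g x)) \<le> (cmod (f x))\<^sup>2 + (cmod (g x))\<^sup>2" for x
    using sum_squares_bound[of "cmod (f x)" "cmod (g x)"] by (simp add: norm_mult mult_ac)
  then have "2 * ennreal (cmod (f x * cnj (g x))) \<le> ennreal ((cmod (f x))\<^sup>2) + ennreal ((cmod (g x))\<^sup>2)" for x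
    by (metis ennreal_leI ennreal_mult' ennreal_numeral ennreal_plus zero_le_numeral zero_le_power2)
  then have "(\<integral>\<^sup>+ x. 2 * ennreal (cmod (f x * cnj (g x))) \<partial>M) \<le>
      (\<integral>\<^sup>+ x. ennreal ((cmod (f x))\<^sup>2) + ennreal ((cmod (g x))\<^sup>2) \<partial>M)"
    by (rule nn_integral_mono)
  also have "\<dots> = (\<integral>\<^sup>+ x. ennreal ((cmod (f x))\<^sup>2) \<partial>M) + (\<integral>\<^sup>+ x. ennreal ((cmod (g x))\<^sup>2) \<partial>M)"
    by (rule nn_integral_add) auto
  also have "\<dots> \<le> 2 * ennreal C"
    unfolding mult_2 by (rule add_mono) (use assms in auto)
  finally have "2 * (\<integral>\<^sup>+ x. ennreal (cmod (f x * cnj (g x))) \<partial>M) \<le> 2 * ennreal C"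
    by (subst (asm) nn_integral_cmult) auto
  then show ?thesis
    by (simp add: ennreal_mult_le_mult_iff)
qed

section \<open>Slices of a Hardy space function and the contour shift\<close>

definition slice_sqnorm :: "(complex ^ 'n \<Rightarrow> complex) \<Rightarrow> real ^ 'n \<Rightarrow> real" where
  "slice_sqnorm F y = (LINT x|lborel. (cmod (F (cpoint x y)))\<^sup>2)"

context
  fixes F :: "complex ^ 'n \<Rightarrow> complex"
  assumes F: "F \<in> hardy_space"
begin

lemma hardy_continuous_on: "continuous_on (tube Gamma1) F"
  using F by (simp add: hardy_space_def holomorphic_several_continuous_on)

lemma slice_measurable [measurable]:
  "y \<in> Gamma1 \<Longrightarrow> (\<lambda>x. F (cpoint x y)) \<in> borel_measurable borel"
  by (intro borel_measurable_continuous_onI continuous_on_compose2[OF hardy_continuous_on])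
    (auto intro!: continuous_intros cpoint_mem_tube)

lemma slice_nn_integral_le:
  assumes "y \<in> Gamma1"
  shows "(\<integral>\<^sup>+ x. ennreal ((cmod (F (cpoint x y)))\<^sup>2) \<partial>lborel) \<le> ennreal (enn2real (hardy_sqnorm F))"
proof -
  have "(\<integral>\<^sup>+ x. ennreal ((cmod (F (cpoint x y)))\<^sup>2) \<partial>lborel) \<le> hardy_sqnorm F"
    unfolding hardy_sqnorm_def by (rule SUP_upper[OF assms])
  also have "\<dots> = ennreal (enn2real (hardy_sqnorm F))"
    using F by (simp add: hardy_space_def)
  finally show ?thesis .
qed

lemma slice_integrable:
  assumes "y \<in> Gamma1"
  shows "integrable lborel (\<lambda>x. (cmod (F (cpoint x y)))\<^sup>2)"
  using slice_nn_integral_le[OF assms] slice_measurable[OF assms]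
  by (intro integrableI_bounded) (auto intro: le_less_trans)

lemma slice_sqnorm_le:
  assumes "y \<in> Gamma1"
  shows "slice_sqnorm F y \<le> enn2real (hardy_sqnorm F)"
  using slice_nn_integral_le[OF assms] unfolding slice_sqnorm_def
  by (subst (asm) nn_integral_eq_integral[OF slice_integrable[OF assms]]) auto

lemma slice_inner_nn_integral_le:
  assumes "y \<in> Gamma1" "y' \<in> Gamma1"
  shows "(\<integral>\<^sup>+ x. ennreal (cmod (F (cpoint x y) * cnj (F (cpoint x y')))) \<partial>lborel)
    \<le> ennreal (enn2real (hardy_sqnorm F))"
  by (rule nn_integral_mult_cnj_le) (use assms slice_measurable slice_nn_integral_le in auto)

lemma slice_inner_integrable:
  assumes "y \<in> Gamma1" "y' \<in> Gamma1"
  shows "integrable lborel (\<lambda>x. F (cpoint x y) * cnj (F (cpoint x y')))"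
  using slice_inner_nn_integral_le[OF assms] slice_measurable[OF assms(1)] slice_measurable[OF assms(2)]
  by (intro integrableI_bounded) (auto intro: le_less_trans)

text \<open>Contour shift without decay estimates: Cauchy's theorem is applied on the unit square in the
  complex direction \<open>h\<close> through each base point \<open>x\<close>. After integration over \<open>x\<close>, translation
  invariance makes the contributions of the two vertical sides cancel exactly.\<close>

lemma slice_inner_shift:
  assumes y: "y \<in> Gamma1" and y': "y' \<in> Gamma1" and yh: "y + h \<in> Gamma1" and yh': "y' - h \<in> Gamma1"
  shows "(LINT x|lborel. F (cpoint x y) * cnj (F (cpoint x y'))) =
    (LINT x|lborel. F (cpoint x (y + h)) * cnj (F (cpoint x (y' - h))))"
proof -
  define M where "M = enn2real (hardy_sqnorm F)"
  \<comment> \<open>The first height rises while the second falls, because of the conjugation: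
    \<open>H (x + Re \<zeta> *\<^sub>R h) (Im \<zeta>)\<close> is holomorphic in
    \<open>\<zeta>\<close>, its second factor being the conjugate of a holomorphic function
    evaluated at \<open>cnj \<zeta>\<close>.\<close>
  define H where "H x t = F (cpoint x (y + t *\<^sub>R h)) * cnj (F (cpoint x (y' - t *\<^sub>R h)))" for x t
  define I where "I t = (LINT x|lborel. H x t)" for t
  have mem: "y + t *\<^sub>R h \<in> Gamma1" "y' - t *\<^sub>R h \<in> Gamma1" if "t \<in> {0..1}" for t
  proof -
    have "(1 - t) *\<^sub>R y + t *\<^sub>R (y + h) \<in> Gamma1" "(1 - t) *\<^sub>R y' + t *\<^sub>R (y' - h) \<in> Gamma1"
      using that by (auto intro!: convexD[OF convex_Gamma1] assms)
    then show "y + t *\<^sub>R h \<in> Gamma1" "y' - t *\<^sub>R h \<in> Gamma1"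
      by (auto simp: algebra_simps)
  qed
  have cH: "continuous_on (S \<times> {0..1}) (\<lambda>p. H (fst p + c *\<^sub>R h) (snd p))" for S c
    unfolding H_def
    by (intro continuous_intros continuous_on_compose2[OF hardy_continuous_on])
      (auto intro!: continuous_intros cpoint_mem_tube mem simp: split_beta)
  have cH': "continuous_on UNIV (\<lambda>x. H x t)" if "t \<in> {0..1}" for t
    unfolding H_def
    by (intro continuous_intros continuous_on_compose2[OF hardy_continuous_on])
      (auto intro!: continuous_intros cpoint_mem_tube mem that)
  have mH: "(\<lambda>x. H x t) \<in> borel_measurable borel" if "t \<in> {0..1}" for t
    by (intro borel_measurable_continuous_onI cH' that)
  have bH: "(\<integral>\<^sup>+ x. ennreal (cmod (H (x + a) t)) \<partial>lborel) \<le> ennreal M" if "t \<in> {0..1}" for a t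
    using slice_inner_nn_integral_le[OF mem[OF that]] mH[OF that]
    by (subst nn_integral_lborel_translate) (auto simp: H_def M_def)
  have I: "(LINT x|lborel. H (x + a) t) = I t" if "t \<in> {0..1}" for a t
    unfolding I_def by (rule integral_lborel_translate[OF mH[OF that]])
  have cG: "continuous_on (UNIV \<times> {0..1}) (\<lambda>p. H (fst p + snd p *\<^sub>R h) c)" if "c \<in> {0..1}" for c
    by (rule continuous_on_compose2[OF cH'[OF that]]) (auto intro!: continuous_intros)
  have hor: "integrable lborel (\<lambda>x. LINT s:{0..1}|lborel. H (x + s *\<^sub>R h) c)"
      "(LINT x|lborel. (LINT s:{0..1}|lborel. H (x + s *\<^sub>R h) c)) = I c" if "c \<in> {0..1}" for c
    using integrable_slab_average[of "\<lambda>x s. H (x + s *\<^sub>R h) c" M]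
      integral_slab_average[of "\<lambda>x s. H (x + s *\<^sub>R h) c" M] cG[OF that] bH[OF that] I[OF that]
    by (auto simp: set_lebesgue_integral_def)
  \<comment> \<open>The value does not depend on \<open>c\<close>, so the sides \<open>c = 0\<close>
    and \<open>c = 1\<close> of the square contribute the same amount.\<close>
  have vert: "integrable lborel (\<lambda>x. LINT t:{0..1}|lborel. H (x + c *\<^sub>R h) t)"
      "(LINT x|lborel. (LINT t:{0..1}|lborel. H (x + c *\<^sub>R h) t)) = (LINT t:{0..1}|lborel. I t)" for c
  proof -
    show "integrable lborel (\<lambda>x. LINT t:{0..1}|lborel. H (x + c *\<^sub>R h) t)"
      by (rule integrable_slab_average[OF cH bH])
    have "(LINT x|lborel. (LINT t:{0..1}|lborel. H (x + c *\<^sub>R h) t)) =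
        (LINT t:{0..1}|lborel. (LINT x|lborel. H (x + c *\<^sub>R h) t))"
      by (rule integral_slab_average[OF cH bH])
    also have "\<dots> = (LINT t:{0..1}|lborel. I t)"
      by (rule set_lebesgue_integral_cong) (auto simp: I)
    finally show "(LINT x|lborel. (LINT t:{0..1}|lborel. H (x + c *\<^sub>R h) t)) = (LINT t:{0..1}|lborel. I t)" .
  qed
  define S where "S = {\<zeta>. y + Im \<zeta> *\<^sub>R h \<in> Gamma1} \<inter> {\<zeta>. y' - Im \<zeta> *\<^sub>R h \<in> Gamma1}"
  have S: "open S" "convex S"
  proof -
    have "S = ((\<lambda>\<zeta>. y + Im \<zeta> *\<^sub>R h) -` Gamma1) \<inter> ((\<lambda>\<zeta>. y' - Im \<zeta> *\<^sub>R h) -` Gamma1)"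
      by (auto simp: S_def)
    then show "open S"
      by (auto intro!: open_Int open_vimage open_Gamma1 continuous_intros)
    show "convex S"
    proof (rule convexI)
      fix a b :: complex and u v :: real
      assume ab: "a \<in> S" "b \<in> S" and uv: "0 \<le> u" "0 \<le> v" "u + v = 1"
      have "u *\<^sub>R (y + Im a *\<^sub>R h) + v *\<^sub>R (y + Im b *\<^sub>R h) \<in> Gamma1"
        "u *\<^sub>R (y' - Im a *\<^sub>R h) + v *\<^sub>R (y' - Im b *\<^sub>R h) \<in> Gamma1"
        using ab by (auto intro!: convexD[OF convex_Gamma1] uv simp: S_def)
      moreover have "u *\<^sub>R (y + Im a *\<^sub>R h) + v *\<^sub>R (y + Im b *\<^sub>R h) = (u + v) *\<^sub>R y + Im (u *\<^sub>R a + v *\<^sub>R b) *\<^sub>R h"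
        "u *\<^sub>R (y' - Im a *\<^sub>R h) + v *\<^sub>R (y' - Im b *\<^sub>R h) = (u + v) *\<^sub>R y' - Im (u *\<^sub>R a + v *\<^sub>R b) *\<^sub>R h"
        by (simp_all add: algebra_simps)
      ultimately show "u *\<^sub>R a + v *\<^sub>R b \<in> S"
        using uv by (simp add: S_def)
    qed
  qed
  have pt: "(LINT s:{0..1}|lborel. H (x + s *\<^sub>R h) 0) + \<i> * (LINT t:{0..1}|lborel. H (x + 1 *\<^sub>R h) t) =
      (LINT s:{0..1}|lborel. H (x + s *\<^sub>R h) 1) + \<i> * (LINT t:{0..1}|lborel. H (x + 0 *\<^sub>R h) t)" for x
  proof -
    define u where "u \<zeta> = H (x + Re \<zeta> *\<^sub>R h) (Im \<zeta>)" for \<zeta>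
    have hol: "holomorphic_several F (tube Gamma1)"
      using F by (simp add: hardy_space_def)
    have 1: "(\<lambda>\<zeta>. F (cpoint (x + Re \<zeta> *\<^sub>R h) (y + Im \<zeta> *\<^sub>R h))) holomorphic_on S"
      by (rule holomorphic_on_subset[OF holomorphic_on_complex_line[OF hol]]) (auto simp: S_def)
    have "(\<lambda>\<zeta>. F (cpoint (x + Re \<zeta> *\<^sub>R h) (y' + Im \<zeta> *\<^sub>R h))) holomorphic_on (cnj ` S)"
      by (rule holomorphic_on_subset[OF holomorphic_on_complex_line[OF hol]]) (auto simp: S_def)
    from holomorphic_on_compose_cnj_cnj[OF this S(1)]
    have 2: "(\<lambda>\<zeta>. cnj (F (cpoint (x + Re \<zeta> *\<^sub>R h) (y' - Im \<zeta> *\<^sub>R h)))) holomorphic_on S"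
      by (simp add: o_def)
    have "u holomorphic_on S"
      unfolding u_def H_def by (rule holomorphic_on_mult[OF 1 2])
    from unit_square_Cauchy[OF this S]
    show ?thesis
      using mem by (simp add: u_def S_def)
  qed
  have "I 0 + \<i> * (LINT t:{0..1}|lborel. I t) =
    (LINT x|lborel. (LINT s:{0..1}|lborel. H (x + s *\<^sub>R h) 0) + \<i> * (LINT t:{0..1}|lborel. H (x + 1 *\<^sub>R h) t))"
    by (subst Bochner_Integration.integral_add)
      (use hor[of 0] vert[of 1] in \<open>simp_all del: scaleR_one\<close>)
  also have "\<dots> = (LINT x|lborel. (LINT s:{0..1}|lborel. H (x + s *\<^sub>R h) 1) + \<i> * (LINT t:{0..1}|lborel. H (x + 0 *\<^sub>R h) t))"
    unfolding pt ..
  also have "\<dots> = I 1 + \<i> * (LINT t:{0..1}|lborel. I t)"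
    by (subst Bochner_Integration.integral_add)
      (use hor[of 1] vert[of 0] in \<open>simp_all del: scaleR_zero_left\<close>)
  finally show ?thesis
    by (simp add: I_def H_def)
qed

text \<open>Shifting by half of \<open>y' - y\<close> brings both slices to the midpoint height,
  where the inner product becomes a squared norm.\<close>

lemma slice_inner_eq:
  assumes "y \<in> Gamma1" "y' \<in> Gamma1"
  shows "(LINT x|lborel. F (cpoint x y) * cnj (F (cpoint x y'))) =
    of_real (slice_sqnorm F ((1/2) *\<^sub>R (y + y')))"
proof -
  define h where "h = (1/2) *\<^sub>R (y' - y)"
  have h: "y + h = (1/2) *\<^sub>R (y + y')" "y' - h = (1/2) *\<^sub>R (y + y')"
    by (auto simp: h_def vec_eq_iff field_simps)
  have "(1/2) *\<^sub>R (y + y') \<in> Gamma1"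
    using assms by (auto simp: Gamma1_def intro!: add_pos_pos)
  then show ?thesis
    using slice_inner_shift[OF assms, of h]
    by (simp add: h complex_norm_square[symmetric] slice_sqnorm_def flip: integral_complex_of_real)
qed

text \<open>Expanding the square leaves the real part of an inner product, which
  \<open>slice_inner_eq\<close> turns into a third slice norm. From here on, distances of slices are
  read off from one real function on the cone.\<close>

lemma slice_diff_sqnorm:
  assumes "y \<in> Gamma1" "y' \<in> Gamma1"
  shows "integrable lborel (\<lambda>x. (cmod (F (cpoint x y) - F (cpoint x y')))\<^sup>2)"
    and "(LINT x|lborel. (cmod (F (cpoint x y) - F (cpoint x y')))\<^sup>2) =
      slice_sqnorm F y + slice_sqnorm F y' - 2 * slice_sqnorm F ((1/2) *\<^sub>R (y + y'))"
proof -
  have eq: "(cmod (a - b))\<^sup>2 = (cmod a)\<^sup>2 + (cmod b)\<^sup>2 - 2 * Re (a * cnj b)" for a b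
    unfolding cmod_power2 by (simp add: power2_eq_square algebra_simps)
  note int = slice_integrable[OF assms(1)] slice_integrable[OF assms(2)] slice_inner_integrable[OF assms]
  show "integrable lborel (\<lambda>x. (cmod (F (cpoint x y) - F (cpoint x y')))\<^sup>2)"
    unfolding eq by (intro Bochner_Integration.integrable_diff Bochner_Integration.integrable_add
        integrable_mult_right integrable_Re int)
  have "(LINT x|lborel. Re (F (cpoint x y) * cnj (F (cpoint x y')))) = slice_sqnorm F ((1/2) *\<^sub>R (y + y'))"
    using slice_inner_eq[OF assms] int(3) by (subst integral_Re) auto
  moreover have "(LINT x|lborel. p x + q x - 2 * r x) =
      (LINT x|lborel. p x) + (LINT x|lborel. q x) - 2 * (LINT x|lborel. r x)"
    if "integrable lborel p" "integrable lborel q" "integrable lborel r" for p q r :: "real ^ 'n \<Rightarrow> real"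
    using that by simp
  note this[OF int(1,2) integrable_Re[OF int(3)]]
  ultimately show "(LINT x|lborel. (cmod (F (cpoint x y) - F (cpoint x y')))\<^sup>2) =
      slice_sqnorm F y + slice_sqnorm F y' - 2 * slice_sqnorm F ((1/2) *\<^sub>R (y + y'))"
    unfolding eq slice_sqnorm_def by metis
qed

end

section \<open>Bounded convex sequences, convergence in \<open>ennreal\<close>, completeness of
  L2\<close>

lemma bounded_convex_seq_antimono:
  fixes a :: "nat \<Rightarrow> real"
  assumes conv: "\<And>k. 2 * a (Suc k) \<le> a k + a (Suc (Suc k))" and bd: "\<And>k. a k \<le> B"
  shows "a 1 \<le> a 0"
proof (rule ccontr)
  assume "\<not> a 1 \<le> a 0"
  then have pos: "0 < a 1 - a 0" by simp
  \<comment> \<open>Convexity makes the increments nondecreasing, so a positive first increment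
    forces at least linear growth, against the bound.\<close>
  have step: "a 1 - a 0 \<le> a (Suc k) - a k" for k
  proof (induction k)
    case (Suc k)
    then show ?case using conv[of k] by linarith
  qed simp
  have "real k * (a 1 - a 0) \<le> a k - a 0" for k
  proof (induction k)
    case (Suc k)
    then show ?case using step[of k] by (simp add: algebra_simps)
  qed simp
  then have "real k * (a 1 - a 0) \<le> B - a 0" for k
    using bd[of k] by (meson diff_right_mono order_trans)
  then show False
    using reals_Archimedean3[OF pos] by (metis not_le)
qed

lemma tendsto_zero_ennrealI:
  fixes f :: "'a \<Rightarrow> ennreal"
  assumes "\<And>e::real. 0 < e \<Longrightarrow> \<forall>\<^sub>F x in F. f x \<le> ennreal e"
  shows "(f \<longlongrightarrow> 0) F"
proof (rule order_tendstoI)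
  fix a :: ennreal assume "0 < a"
  then obtain b where b: "0 < b" "b < a" using dense by blast
  then have "b < top" using less_le_trans[OF b(2) top_greatest] by simp
  then have "ennreal (enn2real b) = b" "0 < enn2real b"
    using b by (simp_all add: enn2real_positive_iff)
  then show "\<forall>\<^sub>F x in F. f x < a"
    using assms[of "enn2real b"] b(2) by (auto elim!: eventually_mono intro: le_less_trans)
qed simp

text \<open>Riesz-Fischer: a rapidly Cauchy subsequence converges almost everywhere, and Fatou's
  lemma transfers the Cauchy estimate to its limit. Only differences of the \<open>f n\<close> have
  to be square integrable.\<close>

lemma L2_Cauchy_imp_limit:
  fixes f :: "nat \<Rightarrow> 'a \<Rightarrow> complex"
  assumes meas [measurable]: "\<And>n. f n \<in> borel_measurable M"
    and cauchy: "\<And>e::real. 0 < e \<Longrightarrow> \<exists>N. \<forall>m\<ge>N. \<forall>n\<ge>N. (\<integral>\<^sup>+ x. ennreal ((cmod (f m x - f n x))\<^sup>2) \<partial>M) \<le> ennreal e"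
  obtains g where "g \<in> borel_measurable M"
    and "\<And>e::real. 0 < e \<Longrightarrow> \<exists>N. \<forall>n\<ge>N. (\<integral>\<^sup>+ x. ennreal ((cmod (f n x - g x))\<^sup>2) \<partial>M) \<le> ennreal e"
proof -
  \<comment> \<open>The rate 1/8 leaves the summable \<open>(1/4) ^ k\<close> after weighting with
    \<open>2 ^ k\<close>; the weight in turn forces geometric decay of the increments at almost
    every point.\<close>
  have "\<forall>k. \<exists>N. \<forall>m\<ge>N. \<forall>n\<ge>N. (\<integral>\<^sup>+ x. ennreal ((cmod (f m x - f n x))\<^sup>2) \<partial>M) \<le> ennreal ((1/8) ^ k)"
    by (intro allI cauchy) simp
  from choice[OF this] obtain N where N: "\<And>k m n. N k \<le> m \<Longrightarrow> N k \<le> n \<Longrightarrow>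
      (\<integral>\<^sup>+ x. ennreal ((cmod (f m x - f n x))\<^sup>2) \<partial>M) \<le> ennreal ((1/8) ^ k)"
    by blast
  \<comment> \<open>Summing the \<open>N i\<close> makes \<open>r k\<close> and
    \<open>r (Suc k)\<close> both at least \<open>N k\<close>, with no monotonicity of
    \<open>N\<close>; the summand \<open>k\<close> sends \<open>r\<close> to infinity.\<close>
  define r where "r k = (\<Sum>i\<le>k. N i) + k" for k
  have rN: "N k \<le> r k" "N k \<le> r (Suc k)" and rk: "k \<le> r k" for k
    using member_le_sum[of k "{..k}" N] by (auto simp: r_def)
  define d where "d k x = f (r (Suc k)) x - f (r k) x" for k x
  have [measurable]: "d k \<in> borel_measurable M" for k unfolding d_def by measurable
  have "(\<integral>\<^sup>+ x. (\<Sum>k. ennreal (2 ^ k * (cmod (d k x))\<^sup>2)) \<partial>M) =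
      (\<Sum>k. \<integral>\<^sup>+ x. ennreal (2 ^ k * (cmod (d k x))\<^sup>2) \<partial>M)"
    by (rule nn_integral_suminf) measurable
  also have "\<dots> \<le> (\<Sum>k. ennreal ((1/4) ^ k))"
  proof (rule suminf_le)
    fix k
    have "(\<integral>\<^sup>+ x. ennreal (2 ^ k * (cmod (d k x))\<^sup>2) \<partial>M) =
        ennreal (2 ^ k) * (\<integral>\<^sup>+ x. ennreal ((cmod (d k x))\<^sup>2) \<partial>M)"
      by (subst nn_integral_cmult[symmetric]) (auto simp: ennreal_mult)
    also have "\<dots> \<le> ennreal (2 ^ k) * ennreal ((1/8) ^ k)"
      unfolding d_def using N rN by (intro mult_left_mono) auto
    also have "\<dots> = ennreal ((1/4) ^ k)"
      by (simp flip: ennreal_mult add: power_mult_distrib[symmetric])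
    finally show "(\<integral>\<^sup>+ x. ennreal (2 ^ k * (cmod (d k x))\<^sup>2) \<partial>M) \<le> ennreal ((1/4) ^ k)" .
  qed auto
  also have "\<dots> < \<infinity>"
    by (subst suminf_ennreal2) (auto intro!: summable_geometric)
  finally have "AE x in M. (\<Sum>k. ennreal (2 ^ k * (cmod (d k x))\<^sup>2)) \<noteq> \<infinity>"
    by (intro nn_integral_noteq_infinite) auto
  then have conv: "AE x in M. convergent (\<lambda>k. f (r k) x)"
  proof eventually_elim
    case (elim x)
    then have summ: "summable (\<lambda>k. 2 ^ k * (cmod (d k x))\<^sup>2)"
      by (intro summable_suminf_not_top) auto
    define B where "B = (\<Sum>k. 2 ^ k * (cmod (d k x))\<^sup>2)"
    have "cmod (d k x) \<le> sqrt B * (sqrt (1/2)) ^ k" for k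
    proof -
      have "2 ^ k * (cmod (d k x))\<^sup>2 \<le> B"
        unfolding B_def using summ by (rule sum_le_suminf[of _ "{k}", simplified]) auto
      then have "(cmod (d k x))\<^sup>2 \<le> B * (1/2) ^ k"
        by (simp add: field_simps)
      then have "sqrt ((cmod (d k x))\<^sup>2) \<le> sqrt (B * (1/2) ^ k)"
        by (rule real_sqrt_le_mono)
      then show ?thesis by (simp add: real_sqrt_mult real_sqrt_power)
    qed
    moreover have "summable (\<lambda>k. sqrt B * (sqrt (1/2)) ^ k)"
      by (intro summable_mult summable_geometric) (simp add: real_sqrt_divide)
    ultimately have "summable (\<lambda>k. d k x)"
      by (rule summable_comparison_test'[rotated])
    then have "convergent (\<lambda>n. \<Sum>k<n. d k x)"
      by (simp add: summable_iff_convergent)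
    then have "convergent (\<lambda>n. (\<Sum>k<n. d k x) + f (r 0) x)"
      by (intro convergent_add convergent_const)
    moreover have "(\<Sum>k<n. d k x) + f (r 0) x = f (r n) x" for n
      unfolding d_def using sum_lessThan_telescope[of "\<lambda>k. f (r k) x" n] by simp
    ultimately show ?case by simp
  qed
  \<comment> \<open>Where the subsequence diverges, \<open>lim\<close> returns an unspecified value;
    by \<open>conv\<close> this happens on a null set only.\<close>
  define g where "g x = lim (\<lambda>k. f (r k) x)" for x
  have g [measurable]: "g \<in> borel_measurable M"
    unfolding g_def by (rule borel_measurable_lim_metric) measurable
  show ?thesis
  proof (rule that[OF g])
    fix e :: real assume "0 < e"
    from cauchy[OF this] obtain K where K: "\<And>m n. K \<le> m \<Longrightarrow> K \<le> n \<Longrightarrow>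
        (\<integral>\<^sup>+ x. ennreal ((cmod (f m x - f n x))\<^sup>2) \<partial>M) \<le> ennreal e"
      by blast
    have "(\<integral>\<^sup>+ x. ennreal ((cmod (f n x - g x))\<^sup>2) \<partial>M) \<le> ennreal e" if n: "K \<le> n" for n
    proof -
      have "(\<integral>\<^sup>+ x. ennreal ((cmod (f n x - g x))\<^sup>2) \<partial>M) =
          (\<integral>\<^sup>+ x. liminf (\<lambda>k. ennreal ((cmod (f n x - f (r k) x))\<^sup>2)) \<partial>M)"
      proof (rule nn_integral_cong_AE)
        show "AE x in M. ennreal ((cmod (f n x - g x))\<^sup>2) = liminf (\<lambda>k. ennreal ((cmod (f n x - f (r k) x))\<^sup>2))"
          using conv
        proof eventually_elim
          case (elim x)
          then have "(\<lambda>k. f (r k) x) \<longlonglongrightarrow> g x"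
            unfolding g_def by (simp add: convergent_LIMSEQ_iff)
          then have "(\<lambda>k. ennreal ((cmod (f n x - f (r k) x))\<^sup>2)) \<longlonglongrightarrow> ennreal ((cmod (f n x - g x))\<^sup>2)"
            by (intro tendsto_ennrealI tendsto_intros)
          from lim_imp_Liminf[OF _ this] show ?case by simp
        qed
      qed
      \<comment> \<open>Fatou's lemma with \<open>n\<close> fixed; the integrals on the right are at
        most \<open>e\<close> once \<open>k\<close>, hence \<open>r k\<close>, is at least
        \<open>K\<close>.\<close>
      also have "\<dots> \<le> liminf (\<lambda>k. \<integral>\<^sup>+ x. ennreal ((cmod (f n x - f (r k) x))\<^sup>2) \<partial>M)"
        by (rule nn_integral_liminf) measurable
      also have "\<dots> \<le> limsup (\<lambda>k. \<integral>\<^sup>+ x. ennreal ((cmod (f n x - f (r k) x))\<^sup>2) \<partial>M)"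
        by (rule Liminf_le_Limsup) simp
      also have "\<dots> \<le> ennreal e"
      proof (rule Limsup_bounded)
        show "\<forall>\<^sub>F k in sequentially. (\<integral>\<^sup>+ x. ennreal ((cmod (f n x - f (r k) x))\<^sup>2) \<partial>M) \<le> ennreal e"
          using eventually_ge_at_top[of K]
        proof eventually_elim
          case (elim k)
          then show ?case using K[OF n, of "r k"] rk[of k] by simp
        qed
      qed
      finally show ?thesis .
    qed
    then show "\<exists>N. \<forall>n\<ge>N. (\<integral>\<^sup>+ x. ennreal ((cmod (f n x - g x))\<^sup>2) \<partial>M) \<le> ennreal e"
      by blast
  qed
qed

lemma eventually_Gamma1_le:
  fixes y0 :: "real ^ 'n"
  assumes "y0 \<in> Gamma1"
  shows "\<forall>\<^sub>F y in at 0 within Gamma1. y \<in> Gamma1 \<and> (\<forall>k. y $ k \<le> y0 $ k)"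
proof (intro eventually_conj eventually_all_finite)
  show "\<forall>\<^sub>F y in at 0 within Gamma1. y \<in> (Gamma1 :: (real ^ 'n) set)"
    by (simp add: eventually_at_filter)
  fix k
  have "((\<lambda>y. y $ k) \<longlongrightarrow> (0 :: real ^ 'n) $ k) (at 0 within Gamma1)"
    by (intro tendsto_intros)
  from order_tendstoD(2)[OF this, of "y0 $ k"]
  show "\<forall>\<^sub>F y in at 0 within Gamma1. y $ k \<le> y0 $ k"
    using assms by (auto simp: Gamma1_def elim!: eventually_mono)
qed

section \<open>Monotonicity of the slice norms and existence of the boundary value\<close>

context
  fixes F :: "complex ^ 'n \<Rightarrow> complex"
  assumes F: "F \<in> hardy_space"
begin

lemma slice_sqnorm_midpoint:
  assumes "y \<in> Gamma1" "y' \<in> Gamma1"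
  shows "2 * slice_sqnorm F ((1/2) *\<^sub>R (y + y')) \<le> slice_sqnorm F y + slice_sqnorm F y'"
proof -
  have "0 \<le> (LINT x|lborel. (cmod (F (cpoint x y) - F (cpoint x y')))\<^sup>2)"
    by (rule Bochner_Integration.integral_nonneg) simp
  then show ?thesis using slice_diff_sqnorm(2)[OF F assms] by simp
qed

text \<open>The slice norm is midpoint convex and bounded on the whole ray from \<open>y\<close> through \<open>y'\<close>.\<close>

lemma slice_sqnorm_antimono:
  fixes y y' :: "real ^ 'n"
  assumes y: "y \<in> Gamma1" and le: "\<And>k. y $ k \<le> y' $ k"
  shows "slice_sqnorm F y' \<le> slice_sqnorm F y"
proof -
  define a where "a k = slice_sqnorm F (y + real k *\<^sub>R (y' - y))" for k
  have mem: "y + real k *\<^sub>R (y' - y) \<in> Gamma1" for k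
    using y le by (auto simp: Gamma1_def intro!: add_pos_nonneg mult_nonneg_nonneg)
  have "a 1 \<le> a 0"
  proof (rule bounded_convex_seq_antimono)
    fix k
    have "(1/2) *\<^sub>R ((y + real k *\<^sub>R (y' - y)) + (y + real (Suc (Suc k)) *\<^sub>R (y' - y))) =
        y + real (Suc k) *\<^sub>R (y' - y)"
      by (simp add: vec_eq_iff field_simps)
    then show "2 * a (Suc k) \<le> a k + a (Suc (Suc k))"
      using slice_sqnorm_midpoint[OF mem[of k] mem[of "Suc (Suc k)"]] by (simp add: a_def)
    show "a k \<le> enn2real (hardy_sqnorm F)"
      unfolding a_def by (rule slice_sqnorm_le[OF F mem])
  qed
  then show ?thesis by (simp add: a_def)
qed

text \<open>Choose \<open>y0\<close> with norm within \<open>e/2\<close> of the supremum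
  \<open>S\<close>. By monotonicity the midpoint of two heights below \<open>y0\<close> also has
  norm above \<open>S - e/2\<close>, so the squared distance is at most
  \<open>2 * S - 2 * (S - e/2) = e\<close>.\<close>

lemma slice_Cauchy:
  fixes e :: real
  assumes "0 < e"
  shows "\<exists>y0\<in>Gamma1. \<forall>y\<in>Gamma1. \<forall>y'\<in>Gamma1. (\<forall>k. y $ k \<le> (y0 :: real ^ 'n) $ k) \<longrightarrow> (\<forall>k. y' $ k \<le> y0 $ k) \<longrightarrow>
      (\<integral>\<^sup>+ x. ennreal ((cmod (F (cpoint x y) - F (cpoint x y')))\<^sup>2) \<partial>lborel) \<le> ennreal e"
proof -
  define N where "N = slice_sqnorm F"
  define S where "S = (SUP y\<in>Gamma1. N y)"
  have bdd: "bdd_above (N ` Gamma1)"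
    using slice_sqnorm_le[OF F] unfolding N_def by (rule bdd_aboveI2)
  have "(\<chi> k. 1) \<in> (Gamma1 :: (real ^ 'n) set)" by (simp add: Gamma1_def)
  then have ne: "(Gamma1 :: (real ^ 'n) set) \<noteq> {}" by blast
  have "S - e/2 < S" using assms by simp
  then obtain y0 where y0: "y0 \<in> Gamma1" "S - e/2 < N y0"
    unfolding S_def by (subst (asm) less_cSUP_iff[OF ne bdd]) auto
  show ?thesis
  proof (intro bexI[OF _ y0(1)] ballI impI)
    fix y y' assume y: "y \<in> Gamma1" "y' \<in> Gamma1" "\<forall>k. y $ k \<le> y0 $ k" "\<forall>k. y' $ k \<le> y0 $ k"
    define m where "m = (1/2) *\<^sub>R (y + y')"
    have m: "m \<in> Gamma1" using y(1,2) by (auto simp: m_def Gamma1_def intro!: add_pos_pos)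
    have "m $ k \<le> y0 $ k" for k
      using y(3,4)[rule_format, of k] by (simp add: m_def)
    then have "N y0 \<le> N m" unfolding N_def by (rule slice_sqnorm_antimono[OF m])
    moreover have "N y \<le> S" "N y' \<le> S"
      unfolding S_def using bdd y by (auto intro: cSUP_upper)
    ultimately have "N y + N y' - 2 * N m \<le> e" using y0(2) by linarith
    then show "(\<integral>\<^sup>+ x. ennreal ((cmod (F (cpoint x y) - F (cpoint x y')))\<^sup>2) \<partial>lborel) \<le> ennreal e"
      using slice_diff_sqnorm[OF F y(1,2)]
      by (subst nn_integral_eq_integral) (auto simp: N_def m_def intro!: ennreal_leI)
  qed
qed

text \<open>Completeness gives a limit \<open>g\<close> along one sequence of heights. Comparing an
  arbitrary small height with a late member of that sequence, by \<open>slice_Cauchy\<close>, makes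
  \<open>g\<close> the limit along the whole cone.\<close>

lemma hardy_boundary_value_exists: "\<exists>f. is_boundary_value F f"
proof -
  define t :: "nat \<Rightarrow> real ^ 'n" where "t n = (\<chi> k. 1 / real (Suc n))" for n
  have t: "t n \<in> Gamma1" for n by (simp add: t_def Gamma1_def)
  have tlim: "filterlim t (at 0 within Gamma1) sequentially"
    unfolding t_def[abs_def] by (rule filterlim_Gamma1_zero)
  note [measurable] = slice_measurable[OF F]
  have meas: "(\<lambda>x. F (cpoint x (t n))) \<in> borel_measurable lborel" for n
    using t by simp
  have ev: "\<forall>\<^sub>F n in sequentially. \<forall>k. t n $ k \<le> y0 $ k" if "y0 \<in> Gamma1" for y0
    using eventually_compose_filterlim[OF eventually_Gamma1_le[OF that] tlim]
    by (rule eventually_mono) simp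
  obtain g where g [measurable]: "g \<in> borel_measurable lborel"
    and lim: "\<And>e::real. 0 < e \<Longrightarrow> \<exists>N. \<forall>n\<ge>N. (\<integral>\<^sup>+ x. ennreal ((cmod (F (cpoint x (t n)) - g x))\<^sup>2) \<partial>lborel) \<le> ennreal e"
  proof (rule L2_Cauchy_imp_limit[OF meas])
    fix e :: real assume "0 < e"
    obtain y0 where y0: "y0 \<in> Gamma1"
      "\<And>y y'. \<lbrakk>y \<in> Gamma1; y' \<in> Gamma1; \<forall>k. y $ k \<le> y0 $ k; \<forall>k. y' $ k \<le> y0 $ k\<rbrakk> \<Longrightarrow>
        (\<integral>\<^sup>+ x. ennreal ((cmod (F (cpoint x y) - F (cpoint x y')))\<^sup>2) \<partial>lborel) \<le> ennreal e"
      using slice_Cauchy[OF \<open>0 < e\<close>] by blast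
    from ev[OF y0(1)] obtain N where "\<And>n. N \<le> n \<Longrightarrow> \<forall>k. t n $ k \<le> y0 $ k"
      unfolding eventually_sequentially by blast
    then show "\<exists>N. \<forall>m\<ge>N. \<forall>n\<ge>N. (\<integral>\<^sup>+ x. ennreal ((cmod (F (cpoint x (t m)) - F (cpoint x (t n))))\<^sup>2) \<partial>lborel) \<le> ennreal e"
      by (intro exI[of _ N] allI impI y0(2) t) auto
  qed auto
  have fin: "(\<integral>\<^sup>+ x. ennreal ((cmod (g x))\<^sup>2) \<partial>lborel) < \<infinity>"
  proof -
    \<comment> \<open>The limit is only known to be close to slices; one slice at squared distance
      at most 1 already gives it finite norm.\<close>
    obtain n where n: "(\<integral>\<^sup>+ x. ennreal ((cmod (F (cpoint x (t n)) - g x))\<^sup>2) \<partial>lborel) \<le> ennreal 1"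
      using lim[of 1] by auto
    have "(\<integral>\<^sup>+ x. ennreal ((cmod (g x))\<^sup>2) \<partial>lborel) \<le>
        2 * (\<integral>\<^sup>+ x. ennreal ((cmod (F (cpoint x (t n)) - g x))\<^sup>2) \<partial>lborel) +
        2 * (\<integral>\<^sup>+ x. ennreal ((cmod (F (cpoint x (t n))))\<^sup>2) \<partial>lborel)"
      using nn_integral_sqnorm_triangle[OF g meas[of n], of "\<lambda>_. 0"] by (simp add: norm_minus_commute)
    also have "\<dots> \<le> 2 * ennreal 1 + 2 * ennreal (enn2real (hardy_sqnorm F))"
      by (intro add_mono mult_left_mono n slice_nn_integral_le[OF F t]) auto
    also have "\<dots> < \<infinity>" by (simp add: ennreal_mult_less_top)
    finally show ?thesis .
  qed
  have "((\<lambda>y. \<integral>\<^sup>+ x. ennreal ((cmod (F (cpoint x y) - g x))\<^sup>2) \<partial>lborel) \<longlongrightarrow> 0) (at 0 within Gamma1)"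
  proof (rule tendsto_zero_ennrealI)
    fix e :: real assume e: "0 < e"
    \<comment> \<open>Two terms of size \<open>e/4\<close>, each doubled by the triangle inequality
      for squares, add up to \<open>e\<close>.\<close>
    then have e4: "0 < e/4" by simp
    obtain y0 where y0: "y0 \<in> Gamma1"
      "\<And>y y'. \<lbrakk>y \<in> Gamma1; y' \<in> Gamma1; \<forall>k. y $ k \<le> y0 $ k; \<forall>k. y' $ k \<le> y0 $ k\<rbrakk> \<Longrightarrow>
        (\<integral>\<^sup>+ x. ennreal ((cmod (F (cpoint x y) - F (cpoint x y')))\<^sup>2) \<partial>lborel) \<le> ennreal (e/4)"
      using slice_Cauchy[OF e4] by blast
    have "\<forall>\<^sub>F n in sequentially. (\<forall>k. t n $ k \<le> y0 $ k) \<and>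
        (\<integral>\<^sup>+ x. ennreal ((cmod (F (cpoint x (t n)) - g x))\<^sup>2) \<partial>lborel) \<le> ennreal (e/4)"
      using ev[OF y0(1)] lim[OF e4] by (intro eventually_conj) (auto simp: eventually_sequentially)
    then obtain n where n: "\<forall>k. t n $ k \<le> y0 $ k"
      "(\<integral>\<^sup>+ x. ennreal ((cmod (F (cpoint x (t n)) - g x))\<^sup>2) \<partial>lborel) \<le> ennreal (e/4)"
      by (auto simp: eventually_sequentially)
    from eventually_Gamma1_le[OF y0(1)]
    show "\<forall>\<^sub>F y in at 0 within Gamma1. (\<integral>\<^sup>+ x. ennreal ((cmod (F (cpoint x y) - g x))\<^sup>2) \<partial>lborel) \<le> ennreal e"
    proof eventually_elim
      case (elim y)
      then have [measurable]: "(\<lambda>x. F (cpoint x y)) \<in> borel_measurable lborel" by simp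
      have "(\<integral>\<^sup>+ x. ennreal ((cmod (F (cpoint x y) - g x))\<^sup>2) \<partial>lborel) \<le>
          2 * (\<integral>\<^sup>+ x. ennreal ((cmod (F (cpoint x y) - F (cpoint x (t n))))\<^sup>2) \<partial>lborel) +
          2 * (\<integral>\<^sup>+ x. ennreal ((cmod (F (cpoint x (t n)) - g x))\<^sup>2) \<partial>lborel)"
        by (rule nn_integral_sqnorm_triangle) (use meas in auto)
      also have "\<dots> \<le> 2 * ennreal (e/4) + 2 * ennreal (e/4)"
        using elim n t y0 by (intro add_mono mult_left_mono) auto
      also have "\<dots> = ennreal 2 * ennreal (e/4) + ennreal 2 * ennreal (e/4)" by simp
      also have "\<dots> = ennreal e"
        using e by (simp only: ennreal_mult[symmetric] ennreal_plus[symmetric]) simp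
      finally show ?case .
    qed
  qed
  then show ?thesis
    using g fin unfolding is_boundary_value_def by blast
qed

end

subsection \<open>Scaling of the kernel\<close>

lemma Basis_real_vec: "(Basis :: (real ^ 'n) set) = range (\<lambda>i. axis i 1)"
  by (auto simp: Basis_vec_def)

lemma prod_Basis_real_vec: "(\<Prod>b\<in>Basis. f (b :: real ^ 'n)) = (\<Prod>i\<in>UNIV. f (axis i 1))"
  unfolding Basis_real_vec by (subst prod.reindex) (auto simp: inj_on_def axis_eq_axis)

text \<open>Substitution of \<open>a $ j + s $ j * t $ j\<close> for the coordinates of
  \<open>x\<close>; the product of the \<open>s $ j\<close> is its Jacobian.\<close>

lemma nn_integral_lborel_affine_vec:
  fixes g :: "real ^ 'n \<Rightarrow> ennreal" and a s :: "real ^ 'n"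
  assumes [measurable]: "g \<in> borel_measurable borel" and s: "\<And>j. 0 < s $ j"
  shows "(\<integral>\<^sup>+ x. g (\<chi> j. (x $ j - a $ j) / s $ j) \<partial>lborel) = ennreal (\<Prod>j\<in>UNIV. s $ j) * (\<integral>\<^sup>+ t. g t \<partial>lborel)"
proof -
  \<comment> \<open>\<open>T\<close> inverts the map inside \<open>g\<close>; the sum over
    \<open>Basis\<close> is the form used by \<open>lborel_affine_euclidean\<close>.\<close>
  define T where "T x = a + (\<Sum>j\<in>Basis. ((s \<bullet> j) * (x \<bullet> j)) *\<^sub>R j)" for x :: "real ^ 'n"
  have T: "T x $ j = a $ j + s $ j * x $ j" for x j
  proof -
    have "(\<Sum>b\<in>Basis. ((s \<bullet> b) * (x \<bullet> b)) *\<^sub>R b) \<bullet> axis j 1 = (s \<bullet> axis j 1) * (x \<bullet> axis j 1)"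
      by (subst inner_sum_left_Basis) (auto simp: Basis_real_vec)
    then show ?thesis by (simp add: T_def inner_axis)
  qed
  have c: "s \<bullet> b \<noteq> 0" if "b \<in> Basis" for b
    using that s by (auto simp: Basis_real_vec inner_axis less_imp_neq[THEN not_sym])
  have [measurable]: "(\<lambda>x :: real ^ 'n. \<chi> j. (x $ j - a $ j) / s $ j) \<in> borel_measurable borel"
    by (intro borel_measurable_continuous_onI continuous_intros) (use s in \<open>auto simp: less_imp_neq[THEN not_sym]\<close>)
  have [measurable]: "T \<in> borel_measurable borel"
    unfolding T_def by measurable
  have "(\<integral>\<^sup>+ x. g (\<chi> j. (x $ j - a $ j) / s $ j) \<partial>lborel) =
      (\<integral>\<^sup>+ x. ennreal (\<Prod>b\<in>Basis. \<bar>s \<bullet> b\<bar>) * g (\<chi> j. (T x $ j - a $ j) / s $ j) \<partial>lborel)"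
    by (subst lborel_affine_euclidean[of "\<lambda>b. s \<bullet> b" a, OF c], assumption)
      (simp add: nn_integral_density nn_integral_distr T_def[symmetric])
  also have "\<dots> = ennreal (\<Prod>j\<in>UNIV. s $ j) * (\<integral>\<^sup>+ t. g t \<partial>lborel)"
    using s by (simp add: T prod_Basis_real_vec inner_axis nn_integral_cmult less_imp_neq[THEN not_sym] less_imp_le)
  finally show ?thesis .
qed

section \<open>The kernel profile: integrability, mass, tail; thin slabs\<close>

definition kernel_profile :: "nat ^ 'n \<Rightarrow> real ^ 'n \<Rightarrow> real" where
  "kernel_profile \<alpha> t = (\<Prod>j\<in>UNIV. (1 / (1 + (t $ j)\<^sup>2)) ^ (\<alpha> $ j + 1))"

lemma kernel_profile_pos: "0 < kernel_profile \<alpha> t"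
  unfolding kernel_profile_def by (intro prod_pos zero_less_power) (simp add: add_pos_nonneg)

lemma kernel_profile_measurable [measurable]: "kernel_profile \<alpha> \<in> borel_measurable borel"
  unfolding kernel_profile_def[abs_def]
  by (intro borel_measurable_continuous_onI continuous_intros) (auto simp: add_nonneg_eq_0_iff)

text \<open>Each factor is at most 1, so exponents may be lowered to 1; what remains is a product of
  one-dimensional integrals of \<open>1 / (1 + t\<^sup>2)\<close>.\<close>

lemma nn_integral_kernel_profile_finite:
  fixes \<alpha> :: "nat ^ 'n"
  shows "(\<integral>\<^sup>+ t. ennreal (kernel_profile \<alpha> t) \<partial>lborel) < \<infinity>"
proof -
  have fin: "(\<integral>\<^sup>+ t. ennreal (1 / (1 + t\<^sup>2)) \<partial>lborel) < (\<infinity> :: ennreal)"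
  proof -
    have "integrable lborel (\<lambda>t::real. 1 / (1 + t\<^sup>2))"
      using integrable_inverse_1_plus_square
      by (simp add: set_integrable_def einterval_def inverse_eq_divide)
    then show ?thesis
      by (auto simp: integrable_iff_bounded)
  qed
  have "(\<integral>\<^sup>+ t. ennreal (kernel_profile \<alpha> t) \<partial>lborel) \<le>
      (\<integral>\<^sup>+ t. (\<Prod>b\<in>Basis. ennreal (1 / (1 + ((t :: real ^ 'n) \<bullet> b)\<^sup>2))) \<partial>lborel)"
  proof (rule nn_integral_mono)
    fix t :: "real ^ 'n"
    have "kernel_profile \<alpha> t \<le> (\<Prod>j\<in>UNIV. (1 / (1 + (t $ j)\<^sup>2)) ^ 1)"
      unfolding kernel_profile_def
      by (intro prod_mono conjI power_decreasing) (auto simp: divide_le_eq_1 add_pos_nonneg)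
    then show "ennreal (kernel_profile \<alpha> t) \<le> (\<Prod>b\<in>Basis. ennreal (1 / (1 + (t \<bullet> b)\<^sup>2)))"
      by (simp add: prod_ennreal prod_Basis_real_vec inner_axis ennreal_leI)
  qed
  also have "\<dots> = (\<Prod>b\<in>(Basis :: (real ^ 'n) set). \<integral>\<^sup>+ t. ennreal (1 / (1 + t\<^sup>2)) \<partial>lborel)"
    by (rule nn_integral_lborel_prod) auto
  also have "\<dots> < \<infinity>"
    using fin by (simp add: power_less_top_ennreal)
  finally show ?thesis .
qed

definition profile_mass :: "nat ^ 'n \<Rightarrow> real" where
  "profile_mass \<alpha> = enn2real (\<integral>\<^sup>+ t. ennreal (kernel_profile \<alpha> t) \<partial>lborel)"

lemma nn_integral_kernel_profile:
  "(\<integral>\<^sup>+ t. ennreal (kernel_profile \<alpha> t) \<partial>lborel) = ennreal (profile_mass \<alpha>)"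
  unfolding profile_mass_def using nn_integral_kernel_profile_finite[of \<alpha>] by simp

lemma profile_mass_pos:
  fixes \<alpha> :: "nat ^ 'n"
  shows "0 < profile_mass \<alpha>"
proof -
  have "(\<integral>\<^sup>+ t. ennreal (kernel_profile \<alpha> t) \<partial>lborel) \<noteq> 0"
  proof
    assume "(\<integral>\<^sup>+ t. ennreal (kernel_profile \<alpha> t) \<partial>lborel) = 0"
    then have "AE t in lborel. ennreal (kernel_profile \<alpha> t) = 0"
      by (subst (asm) nn_integral_0_iff_AE) auto
    then have "AE t in (lborel :: (real ^ 'n) measure). False"
    proof eventually_elim
      case (elim t)
      then show False using kernel_profile_pos[of \<alpha> t] by simp
    qed
    then show False
      by (simp add: eventually_False ae_filter_eq_bot_iff)
  qed
  then show ?thesis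
    unfolding nn_integral_kernel_profile by (simp add: ennreal_eq_0_iff)
qed

text \<open>Dominated convergence with the profile as majorant. In rescaled coordinates this tail is
  the mass of the kernel away from the slab around \<open>x $ k\<close>.\<close>

lemma kernel_profile_tail:
  fixes \<alpha> :: "nat ^ 'n"
  assumes "0 < (e::real)"
  obtains r :: real where "0 < r"
    "(\<integral>\<^sup>+ t. ennreal (kernel_profile \<alpha> t) * indicator {t. r \<le> \<bar>t $ k\<bar>} t \<partial>lborel) \<le> ennreal e"
proof -
  \<comment> \<open>\<open>Suc n\<close> rather than \<open>n\<close> keeps the threshold
    positive.\<close>
  define u where "u n t = ennreal (kernel_profile \<alpha> t) * indicator {t. real (Suc n) \<le> \<bar>t $ k\<bar>} t" for n t
  have "(\<lambda>n. \<integral>\<^sup>+ t. u n t \<partial>lborel) \<longlonglongrightarrow> (\<integral>\<^sup>+ t. 0 \<partial>(lborel :: (real ^ 'n) measure))"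
  proof (rule nn_integral_dominated_convergence[where w = "\<lambda>t. ennreal (kernel_profile \<alpha> t)"])
    show "AE t in lborel. (\<lambda>n. u n t) \<longlonglongrightarrow> 0"
    proof (rule AE_I2)
      fix t :: "real ^ 'n"
      obtain N :: nat where N: "\<bar>t $ k\<bar> < real N" using reals_Archimedean2 by blast
      have "u n t = 0" if "N \<le> n" for n
        using N that by (auto simp: u_def indicator_def)
      then have "\<forall>\<^sub>F n in sequentially. u n t = 0"
        by (auto simp: eventually_sequentially)
      then show "(\<lambda>n. u n t) \<longlonglongrightarrow> 0" by (rule tendsto_eventually)
    qed
    show "(\<integral>\<^sup>+ t. ennreal (kernel_profile \<alpha> t) \<partial>lborel) < \<infinity>"
      by (rule nn_integral_kernel_profile_finite)
  qed (auto simp: u_def indicator_def)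
  from order_tendstoD(2)[OF this, of "ennreal e"] assms
  obtain n where "(\<integral>\<^sup>+ t. u n t \<partial>lborel) < ennreal e"
    by (auto simp: eventually_sequentially)
  then show ?thesis
    by (intro that[of "real (Suc n)"]) (auto simp: u_def)
qed

text \<open>Outside a set \<open>B m\<close> on which \<open>f\<close> and the coordinates are
  bounded, the mass of \<open>f\<close> is small. Inside it, a slab meets a box whose volume is
  proportional to \<open>d\<close> and independent of the position \<open>a\<close>, whence one
  \<open>d\<close> for all \<open>a\<close>.\<close>

lemma thin_slab_small:
  fixes f :: "real ^ 'n \<Rightarrow> complex"
  assumes [measurable]: "f \<in> borel_measurable borel"
    and fin: "(\<integral>\<^sup>+ x. ennreal ((cmod (f x))\<^sup>2) \<partial>lborel) < \<infinity>"
    and e: "0 < (e::real)"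
  obtains d :: real where "0 < d"
    "\<And>a. (\<integral>\<^sup>+ x. ennreal ((cmod (f x))\<^sup>2) * indicator {x. \<bar>x $ k - a\<bar> < d} x \<partial>lborel) \<le> ennreal e"
proof -
  define B where "B m = {x. (cmod (f x))\<^sup>2 \<le> real m \<and> (\<forall>j. \<bar>x $ j\<bar> \<le> real m)}" for m
  define u where "u m x = ennreal ((cmod (f x))\<^sup>2) * indicator (- B m) x" for m x
  have [measurable]: "B m \<in> sets borel" for m
    unfolding B_def by measurable
  have [measurable]: "u m \<in> borel_measurable borel" for m
    unfolding u_def[abs_def] by measurable
  have "(\<lambda>m. \<integral>\<^sup>+ x. u m x \<partial>lborel) \<longlonglongrightarrow> (\<integral>\<^sup>+ x. 0 \<partial>(lborel :: (real ^ 'n) measure))"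
  proof (rule nn_integral_dominated_convergence[where w = "\<lambda>x. ennreal ((cmod (f x))\<^sup>2)"])
    show "AE x in lborel. (\<lambda>m. u m x) \<longlonglongrightarrow> 0"
    proof (rule AE_I2)
      fix x :: "real ^ 'n"
      obtain N :: nat where N: "(cmod (f x))\<^sup>2 + (\<Sum>j\<in>UNIV. \<bar>x $ j\<bar>) < real N" using reals_Archimedean2 by blast
      have "\<bar>x $ j\<bar> \<le> (\<Sum>j\<in>UNIV. \<bar>x $ j\<bar>)" for j
        by (rule member_le_sum) auto
      moreover have "0 \<le> (\<Sum>j\<in>UNIV. \<bar>x $ j\<bar>)" by (intro sum_nonneg) simp
      ultimately have "(cmod (f x))\<^sup>2 \<le> real N" "\<bar>x $ j\<bar> \<le> real N" for j
        using N zero_le_power2[of "cmod (f x)"] by (meson add_increasing add_increasing2 le_less_trans less_imp_le order_refl order_trans)+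
      then have "u m x = 0" if "N \<le> m" for m
        using that by (auto simp: u_def indicator_def B_def) (meson of_nat_le_iff order_trans)+
      then have "\<forall>\<^sub>F m in sequentially. u m x = 0"
        by (auto simp: eventually_sequentially)
      then show "(\<lambda>m. u m x) \<longlonglongrightarrow> 0" by (rule tendsto_eventually)
    qed
  qed (use fin in \<open>auto simp: u_def indicator_def\<close>)
  from order_tendstoD(2)[OF this, of "ennreal (e/2)"] e
  obtain m where m: "(\<integral>\<^sup>+ x. u m x \<partial>lborel) < ennreal (e/2)"
    by (auto simp: eventually_sequentially)
  \<comment> \<open>The bounded part contributes at most \<open>2 * d * V\<close>, which the choice
    of \<open>d\<close> makes at most \<open>e / 2\<close>; the \<open>+ 1\<close> guards against
    \<open>V = 0\<close>.\<close>
  define V where "V = real m * (2 * real m) ^ (CARD('n) - 1)"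
  define d where "d = e / (4 * (V + 1))"
  have V: "0 \<le> V" by (simp add: V_def)
  then have d: "0 < d" using e by (simp add: d_def)
  show ?thesis
  proof (rule that[OF d])
    fix a :: real
    \<comment> \<open>Coordinate \<open>k\<close> is confined by the slab alone and the others by
      \<open>B m\<close>, so the volume of the box does not involve \<open>a\<close>.\<close>
    define l r :: "real ^ 'n" where "l = (\<chi> j. if j = k then a - d else - real m)"
      and "r = (\<chi> j. if j = k then a + d else real m)"
    have lr: "l $ j \<le> r $ j" for j using d by (simp add: l_def r_def)
    have "emeasure lborel (cbox l r) = ennreal (\<Prod>b\<in>Basis. (r - l) \<bullet> b)"
      by (rule emeasure_lborel_cbox) (use lr in \<open>auto simp: Basis_real_vec inner_axis\<close>)
    also have "(\<Prod>b\<in>Basis. (r - l) \<bullet> b) = (\<Prod>j\<in>UNIV. r $ j - l $ j)"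
      using prod_Basis_real_vec[of "\<lambda>b. (r - l) \<bullet> b"] by (simp add: inner_axis)
    also have "\<dots> = (r $ k - l $ k) * (\<Prod>j\<in>UNIV - {k}. r $ j - l $ j)"
      by (rule prod.remove) auto
    also have "(\<Prod>j\<in>UNIV - {k}. r $ j - l $ j) = (\<Prod>j\<in>UNIV - {k}. 2 * real m)"
      by (intro prod.cong) (auto simp: l_def r_def)
    finally have vol: "emeasure lborel (cbox l r) = ennreal (2 * d * (2 * real m) ^ (CARD('n) - 1))"
      by (simp add: l_def r_def)
    have "ennreal ((cmod (f x))\<^sup>2) * indicator {x. \<bar>x $ k - a\<bar> < d} x \<le>
        u m x + ennreal (real m) * indicator (cbox l r) x" for x
    proof (cases "x \<in> B m")
      case True
      then have "x \<in> cbox l r" if "\<bar>x $ k - a\<bar> < d"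
        using that by (auto simp: mem_box_cart l_def r_def B_def abs_le_iff minus_le_iff)
      then show ?thesis
        using True by (auto simp: u_def indicator_def B_def intro!: ennreal_leI)
    qed (auto simp: u_def indicator_def)
    then have "(\<integral>\<^sup>+ x. ennreal ((cmod (f x))\<^sup>2) * indicator {x. \<bar>x $ k - a\<bar> < d} x \<partial>lborel) \<le>
        (\<integral>\<^sup>+ x. u m x + ennreal (real m) * indicator (cbox l r) x \<partial>lborel)"
      by (rule nn_integral_mono)
    also have "\<dots> = (\<integral>\<^sup>+ x. u m x \<partial>lborel) + ennreal (real m) * emeasure lborel (cbox l r)"
      by (subst nn_integral_add) (auto simp: nn_integral_cmult)
    also have "\<dots> \<le> ennreal (e/2) + ennreal (2 * d * V)"
      unfolding vol using m d by (intro add_mono) (auto simp: V_def ennreal_mult[symmetric] mult_ac)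
    also have "\<dots> \<le> ennreal e"
    proof -
      have "2 * d * V \<le> e / 2"
        using V e by (simp add: d_def field_simps)
      then show ?thesis
        using e d V by (simp flip: ennreal_plus)
    qed
    finally show "(\<integral>\<^sup>+ x. ennreal ((cmod (f x))\<^sup>2) * indicator {x. \<bar>x $ k - a\<bar> < d} x \<partial>lborel) \<le> ennreal e" .
  qed
qed

text \<open>On a slice, \<open>\<bar>phi\<bar>\<^sup>2\<close> is \<open>kernel_scale\<close> times a translated and dilated \<open>kernel_profile\<close>;
  \<open>kernel_mass\<close> is the resulting squared norm up to the constant \<open>profile_mass\<close>.\<close>

definition kernel_scale :: "nat ^ 'n \<Rightarrow> real ^ 'n \<Rightarrow> real" where
  "kernel_scale \<alpha> s = (1 / (2 * pi)) ^ (2 * CARD('n)) * (\<Prod>j\<in>UNIV. (fact (\<alpha> $ j))\<^sup>2 / (s $ j) ^ (2 * \<alpha> $ j + 2))"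

definition kernel_mass :: "nat ^ 'n \<Rightarrow> real ^ 'n \<Rightarrow> real" where
  "kernel_mass \<alpha> s = (1 / (2 * pi)) ^ (2 * CARD('n)) * (\<Prod>j\<in>UNIV. (fact (\<alpha> $ j))\<^sup>2 / (s $ j) ^ (2 * \<alpha> $ j + 1))"

text \<open>The product of the \<open>s $ j\<close> is the Jacobian of the rescaling to the profile;
  it lowers each exponent by one.\<close>

lemma kernel_scale_mult_prod:
  fixes s :: "real ^ 'n"
  assumes "\<And>j. 0 < s $ j"
  shows "kernel_scale \<alpha> s * (\<Prod>j\<in>UNIV. s $ j) = kernel_mass \<alpha> s"
proof -
  have "(\<Prod>j\<in>UNIV. (fact (\<alpha> $ j))\<^sup>2 / (s $ j) ^ (2 * \<alpha> $ j + 2)) * (\<Prod>j\<in>UNIV. s $ j) =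
      (\<Prod>j\<in>UNIV. (fact (\<alpha> $ j))\<^sup>2 / (s $ j) ^ (2 * \<alpha> $ j + 1))"
    unfolding prod.distrib[symmetric]
    by (intro prod.cong) (use assms in \<open>auto simp: field_simps less_imp_neq[THEN not_sym]\<close>)
  then show ?thesis by (simp add: kernel_scale_def kernel_mass_def mult.assoc)
qed

lemma kernel_mass_pos:
  fixes s :: "real ^ 'n"
  assumes "\<And>j. 0 < s $ j"
  shows "0 < kernel_mass \<alpha> s"
  unfolding kernel_mass_def using assms by (intro mult_pos_pos prod_pos) auto

lemma kernel_scale_pos:
  fixes s :: "real ^ 'n"
  assumes "\<And>j. 0 < s $ j"
  shows "0 < kernel_scale \<alpha> s"
  unfolding kernel_scale_def using assms by (intro mult_pos_pos prod_pos) auto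

lemma kernel_mass_antimono:
  fixes s s' :: "real ^ 'n"
  assumes "\<And>j. 0 < s $ j" "\<And>j. s $ j \<le> s' $ j"
  shows "kernel_mass \<alpha> s' \<le> kernel_mass \<alpha> s"
proof -
  have "(fact (\<alpha> $ j))\<^sup>2 / (s' $ j) ^ (2 * \<alpha> $ j + 1) \<le> (fact (\<alpha> $ j))\<^sup>2 / (s $ j) ^ (2 * \<alpha> $ j + 1)"
    "0 \<le> (fact (\<alpha> $ j))\<^sup>2 / (s' $ j) ^ (2 * \<alpha> $ j + 1)" for j
  proof -
    have "0 < s $ j" "s $ j \<le> s' $ j" using assms by auto
    then show "(fact (\<alpha> $ j))\<^sup>2 / (s' $ j) ^ (2 * \<alpha> $ j + 1) \<le> (fact (\<alpha> $ j))\<^sup>2 / (s $ j) ^ (2 * \<alpha> $ j + 1)"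
      "0 \<le> (fact (\<alpha> $ j))\<^sup>2 / (s' $ j) ^ (2 * \<alpha> $ j + 1)"
      by (intro divide_left_mono power_mono mult_pos_pos zero_less_power divide_nonneg_nonneg zero_le_power; simp)+
  qed
  then show ?thesis
    unfolding kernel_mass_def by (intro mult_left_mono prod_mono conjI) auto
qed

text \<open>Homogeneity in \<open>s\<close>. It serves the slice of \<open>phi\<close> at its own
  height \<open>y\<close>, where the scale is \<open>y + y\<close>.\<close>

lemma kernel_mass_double:
  "kernel_mass \<alpha> (s + s) = (\<Prod>j\<in>UNIV. (1/2) ^ (2 * \<alpha> $ j + 1)) * kernel_mass \<alpha> s"
proof -
  have "(\<Prod>j\<in>UNIV. (fact (\<alpha> $ j))\<^sup>2 / ((s + s) $ j) ^ (2 * \<alpha> $ j + 1)) =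
      (\<Prod>j\<in>UNIV. (1/2) ^ (2 * \<alpha> $ j + 1) * ((fact (\<alpha> $ j))\<^sup>2 / (s $ j) ^ (2 * \<alpha> $ j + 1)))"
  proof (rule prod.cong)
    fix j
    have "(s + s) $ j = 2 * s $ j" by simp
    then show "(fact (\<alpha> $ j))\<^sup>2 / ((s + s) $ j) ^ (2 * \<alpha> $ j + 1) =
        (1/2) ^ (2 * \<alpha> $ j + 1) * ((fact (\<alpha> $ j))\<^sup>2 / (s $ j) ^ (2 * \<alpha> $ j + 1))"
      by (simp only: power_mult_distrib power_divide) simp
  qed simp
  then show ?thesis
    by (simp only: kernel_mass_def prod.distrib) (simp only: mult_ac)
qed

section \<open>Modulus, continuity and L2 norm of \<open>phi\<close> on slices\<close>

lemma phi_cpoint: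
  fixes x y x' y' :: "real ^ 'n"
  assumes "\<And>j. 0 < y $ j + y' $ j"
  shows "phi \<alpha> (cpoint x y) (cpoint x' y') = (- 1 / (2 * of_real pi * \<i>)) ^ CARD('n) *
    (\<Prod>j\<in>UNIV. fact (\<alpha> $ j) / (Complex (x' $ j - x $ j) (y $ j + y' $ j)) ^ (\<alpha> $ j + 1))"
proof -
  have "cpoint x' y' $ j - cnj (cpoint x y $ j) = Complex (x' $ j - x $ j) (y $ j + y' $ j)" for j
    by (simp add: cpoint_def complex_eq_iff)
  moreover have "cpoint x' y' $ j \<noteq> cnj (cpoint x y $ j)" for j
    using assms[of j] by (auto simp: cpoint_def complex_eq_iff)
  ultimately show ?thesis by (subst phi_eq) auto
qed

text \<open>The factor in coordinate \<open>j\<close> has base with real part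
  \<open>x' $ j - x $ j\<close> and imaginary part \<open>(y + y') $ j\<close>; pulling the latter
  out of the modulus leaves the profile. Positivity is required of the sum of heights only, so the
  boundary slice \<open>y' = 0\<close> is included.\<close>

lemma cmod_phi_sq:
  fixes x y x' y' :: "real ^ 'n"
  assumes s: "\<And>j. 0 < (y + y') $ j"
  shows "(cmod (phi \<alpha> (cpoint x y) (cpoint x' y')))\<^sup>2 =
    kernel_scale \<alpha> (y + y') * kernel_profile \<alpha> (\<chi> j. (x' $ j - x $ j) / (y + y') $ j)"
proof -
  have f: "(fact (\<alpha> $ j) / cmod (Complex (x' $ j - x $ j) (y $ j + y' $ j)) ^ (\<alpha> $ j + 1))\<^sup>2 =
      (fact (\<alpha> $ j))\<^sup>2 / ((y + y') $ j) ^ (2 * \<alpha> $ j + 2) *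
      (1 / (1 + ((x' $ j - x $ j) / (y + y') $ j)\<^sup>2)) ^ (\<alpha> $ j + 1)" for j
  proof -
    define r and u :: real where "r = (y + y') $ j" and "u = x' $ j - x $ j"
    have r: "0 < r" using s[of j] by (simp add: r_def)
    have "(cmod (Complex u r) ^ (\<alpha> $ j + 1))\<^sup>2 = (u\<^sup>2 + r\<^sup>2) ^ (\<alpha> $ j + 1)"
      by (simp only: power_mult[symmetric] mult.commute[of _ 2]) (simp only: power_mult cmod_power2 complex.sel)
    also have "u\<^sup>2 + r\<^sup>2 = r\<^sup>2 * (1 + (u / r)\<^sup>2)"
      using r by (simp add: field_simps power2_eq_square)
    also have "(r\<^sup>2 * (1 + (u / r)\<^sup>2)) ^ (\<alpha> $ j + 1) = r ^ (2 * \<alpha> $ j + 2) * (1 + (u / r)\<^sup>2) ^ (\<alpha> $ j + 1)"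
      by (simp only: power_mult_distrib power_mult[symmetric]) simp
    finally have "(fact (\<alpha> $ j) / cmod (Complex u r) ^ (\<alpha> $ j + 1))\<^sup>2 =
        (fact (\<alpha> $ j))\<^sup>2 / (r ^ (2 * \<alpha> $ j + 2) * (1 + (u / r)\<^sup>2) ^ (\<alpha> $ j + 1))"
      by (simp only: power_divide)
    then show ?thesis
      by (simp only: r_def u_def vector_add_component power_divide power_one divide_divide_eq_left times_divide_eq_right mult_1_right)
  qed
  have "cmod (phi \<alpha> (cpoint x y) (cpoint x' y')) = (1 / (2 * pi)) ^ CARD('n) *
      (\<Prod>j\<in>UNIV. fact (\<alpha> $ j) / cmod (Complex (x' $ j - x $ j) (y $ j + y' $ j)) ^ (\<alpha> $ j + 1))"
    using s by (subst phi_cpoint) (simp_all add: norm_mult norm_power norm_divide prod_norm[symmetric] del: power_Suc)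
  then have "(cmod (phi \<alpha> (cpoint x y) (cpoint x' y')))\<^sup>2 = (1 / (2 * pi)) ^ (2 * CARD('n)) *
      (\<Prod>j\<in>UNIV. (fact (\<alpha> $ j) / cmod (Complex (x' $ j - x $ j) (y $ j + y' $ j)) ^ (\<alpha> $ j + 1))\<^sup>2)"
    by (simp only: power_mult_distrib prod_power_distrib power_mult[symmetric] mult.commute[of _ 2])
  then show ?thesis
    unfolding f prod.distrib kernel_scale_def kernel_profile_def vec_lambda_beta by (simp only: mult.assoc)
qed

lemma continuous_on_phi:
  fixes z :: "complex ^ 'n"
  shows "continuous_on {w. \<forall>j. w $ j \<noteq> cnj (z $ j)} (phi \<alpha> z)"
proof -
  have "continuous_on {w. \<forall>j. w $ j \<noteq> cnj (z $ j)}
      (\<lambda>w. (- 1 / (2 * of_real pi * \<i>)) ^ CARD('n) * (\<Prod>j\<in>UNIV. fact (\<alpha> $ j) / (w $ j - cnj (z $ j)) ^ (\<alpha> $ j + 1)))"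
    by (intro continuous_intros) auto
  then show ?thesis
    by (rule continuous_on_eq) (subst phi_eq, auto)
qed

lemma continuous_on_phi_cpoint:
  fixes f g :: "'a::topological_space \<Rightarrow> real ^ 'n" and y :: "real ^ 'n"
  assumes "continuous_on S f" "continuous_on S g" "\<And>p j. p \<in> S \<Longrightarrow> 0 < y $ j + g p $ j"
  shows "continuous_on S (\<lambda>p. phi \<alpha> (cpoint x y) (cpoint (f p) (g p)))"
proof (rule continuous_on_compose2[OF continuous_on_phi])
  show "continuous_on S (\<lambda>p. cpoint (f p) (g p))"
    by (intro continuous_intros assms)
  show "(\<lambda>p. cpoint (f p) (g p)) ` S \<subseteq> {w. \<forall>j. w $ j \<noteq> cnj (cpoint x y $ j)}"
  proof clarify
    fix p j assume "p \<in> S" "cpoint (f p) (g p) $ j = cnj (cpoint x y $ j)"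
    then show False using assms(3)[of p j] by (simp add: cpoint_def complex_eq_iff)
  qed
qed

lemma phi_slice_measurable:
  fixes y y' :: "real ^ 'n"
  assumes "\<And>j. 0 < (y + y') $ j"
  shows "(\<lambda>\<xi>. phi \<alpha> (cpoint x y) (cpoint \<xi> y')) \<in> borel_measurable borel"
  using assms by (intro borel_measurable_continuous_onI continuous_on_phi_cpoint continuous_intros) auto

text \<open>Rescaling around \<open>x\<close> turns the condition on \<open>\<xi> $ k\<close> into a
  fixed tail of the profile. The result is free of \<open>x\<close>, which is one source of
  uniformity; \<open>r = 0\<close> gives the full norm.\<close>

lemma nn_integral_phi_sq:
  fixes y y' :: "real ^ 'n"
  assumes s: "\<And>j. 0 < (y + y') $ j"
  shows "(\<integral>\<^sup>+ \<xi>. ennreal ((cmod (phi \<alpha> (cpoint x y) (cpoint \<xi> y')))\<^sup>2) * indicator {\<xi>. r \<le> \<bar>(\<xi> $ k - x $ k) / (y + y') $ k\<bar>} \<xi> \<partial>lborel) =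
    ennreal (kernel_mass \<alpha> (y + y')) *
      (\<integral>\<^sup>+ t. ennreal (kernel_profile \<alpha> t) * indicator {t. r \<le> \<bar>t $ k\<bar>} t \<partial>lborel)"
proof -
  define g where "g t = ennreal (kernel_scale \<alpha> (y + y') * kernel_profile \<alpha> t) * indicator {t. r \<le> \<bar>t $ k\<bar>} t" for t
  have [measurable]: "g \<in> borel_measurable borel"
    unfolding g_def[abs_def] by measurable
  have "(\<integral>\<^sup>+ \<xi>. ennreal ((cmod (phi \<alpha> (cpoint x y) (cpoint \<xi> y')))\<^sup>2) * indicator {\<xi>. r \<le> \<bar>(\<xi> $ k - x $ k) / (y + y') $ k\<bar>} \<xi> \<partial>lborel) =
      (\<integral>\<^sup>+ \<xi>. g (\<chi> j. (\<xi> $ j - x $ j) / (y + y') $ j) \<partial>lborel)"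
    unfolding cmod_phi_sq[OF s] g_def by (intro nn_integral_cong) (auto simp: indicator_def)
  also have "\<dots> = ennreal (\<Prod>j\<in>UNIV. (y + y') $ j) * (\<integral>\<^sup>+ t. g t \<partial>lborel)"
    by (rule nn_integral_lborel_affine_vec) (use s in auto)
  also have "(\<integral>\<^sup>+ t. g t \<partial>lborel) = ennreal (kernel_scale \<alpha> (y + y')) *
      (\<integral>\<^sup>+ t. ennreal (kernel_profile \<alpha> t) * indicator {t. r \<le> \<bar>t $ k\<bar>} t \<partial>lborel)"
    unfolding g_def using kernel_scale_pos[OF s, of \<alpha>]
    by (subst nn_integral_cmult[symmetric]) (auto simp: ennreal_mult kernel_profile_pos less_imp_le mult.assoc)
  finally show ?thesis
    unfolding kernel_scale_mult_prod[OF s, symmetric] using kernel_scale_pos[OF s, of \<alpha>] s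
    by (simp add: ennreal_mult prod_nonneg less_imp_le mult_ac)
qed

lemma nn_integral_phi_sq_UNIV:
  fixes y y' :: "real ^ 'n"
  assumes s: "\<And>j. 0 < (y + y') $ j"
  shows "(\<integral>\<^sup>+ \<xi>. ennreal ((cmod (phi \<alpha> (cpoint x y) (cpoint \<xi> y')))\<^sup>2) \<partial>lborel) =
    ennreal (kernel_mass \<alpha> (y + y') * profile_mass \<alpha>)"
  using nn_integral_phi_sq[OF s, where r = 0] kernel_mass_pos[OF s, of \<alpha>] profile_mass_pos[of \<alpha>]
  by (simp add: nn_integral_kernel_profile ennreal_mult)

subsection \<open>Decay of the normalised pairing\<close>

text \<open>Passing through \<open>2 * max a b\<close> gives a constant that is not sharp but needs
  no subtraction and covers infinite values.\<close>

lemma ennreal_power2_add_le: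
  fixes a b :: ennreal
  shows "(a + b)\<^sup>2 \<le> 4 * (a\<^sup>2 + b\<^sup>2)"
proof -
  have "(a + b)\<^sup>2 \<le> (2 * max a b)\<^sup>2"
    unfolding mult_2 by (intro power_mono add_mono) auto
  also have "\<dots> = 4 * (max a b)\<^sup>2" by (simp add: power_mult_distrib)
  also have "(max a b)\<^sup>2 \<le> a\<^sup>2 + b\<^sup>2" by (simp add: max_def)
  finally show ?thesis by (simp add: mult_left_mono)
qed

text \<open>On the slab \<open>A\<close>, \<open>f\<close> has mass at most \<open>e1\<close>
  against the full mass of the kernel; off \<open>A\<close>, the kernel has only its tail, of size
  \<open>e2\<close>, against the full mass of \<open>f\<close>. Neither \<open>d\<close> nor
  \<open>r\<close> depends on \<open>x\<close>.\<close>

lemma pairing_phi_small: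
  fixes f :: "real ^ 'n \<Rightarrow> complex" and \<alpha> :: "nat ^ 'n"
  assumes f [measurable]: "f \<in> borel_measurable borel"
    and fin: "(\<integral>\<^sup>+ x. ennreal ((cmod (f x))\<^sup>2) \<partial>lborel) < \<infinity>"
    and e: "0 < (e::real)"
  obtains \<eta> :: real where "0 < \<eta>"
    "\<And>x y. \<lbrakk>y \<in> Gamma1; y $ k < \<eta>\<rbrakk> \<Longrightarrow>
      (\<integral>\<^sup>+ \<xi>. ennreal (cmod (f \<xi>)) * ennreal (cmod (phi \<alpha> (cpoint x y) (cpoint \<xi> 0))) \<partial>lborel)\<^sup>2
        \<le> ennreal (e * kernel_mass \<alpha> y)"
proof -
  define N where "N = enn2real (\<integral>\<^sup>+ x. ennreal ((cmod (f x))\<^sup>2) \<partial>lborel)"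
  have N: "(\<integral>\<^sup>+ x. ennreal ((cmod (f x))\<^sup>2) \<partial>lborel) = ennreal N" "0 \<le> N"
    using fin by (simp_all add: N_def)
  define Q where "Q = profile_mass \<alpha>"
  have Q: "0 < Q" by (simp add: Q_def profile_mass_pos)
  \<comment> \<open>Chosen so that each of \<open>4 * e1 * Q\<close> and \<open>4 * N * e2\<close>
    is at most \<open>e / 2\<close>; the \<open>+ 1\<close> in \<open>e2\<close> covers
    \<open>N = 0\<close>.\<close>
  define e1 e2 where "e1 = e / (8 * (Q + 1))" and "e2 = e / (8 * (N + 1))"
  have e12: "0 < e1" "0 < e2" using e Q N(2) by (simp_all add: e1_def e2_def)
  obtain d where d: "0 < d"
    "\<And>a. (\<integral>\<^sup>+ x. ennreal ((cmod (f x))\<^sup>2) * indicator {x. \<bar>x $ k - a\<bar> < d} x \<partial>lborel) \<le> ennreal e1"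
    by (rule thin_slab_small[OF f fin e12(1), of k]) blast
  obtain r where r: "0 < r"
    "(\<integral>\<^sup>+ t. ennreal (kernel_profile \<alpha> t) * indicator {t. r \<le> \<bar>t $ k\<bar>} t \<partial>lborel) \<le> ennreal e2"
    by (rule kernel_profile_tail[OF e12(2), of \<alpha> k]) blast
  \<comment> \<open>If \<open>y $ k < d / r\<close>, then distance at least \<open>d\<close> from
    \<open>x $ k\<close> means at least \<open>r\<close> after division by \<open>y $ k\<close>, so
    the complement of the slab lies in the tail.\<close>
  show ?thesis
  proof (rule that[of "d / r"])
    show "0 < d / r" using d r by simp
    fix x y :: "real ^ 'n"
    assume y: "y \<in> Gamma1" "y $ k < d / r"
    have s: "0 < (y + 0) $ j" for j using y(1) by (simp add: Gamma1_def)
    define P where "P \<xi> = ennreal (cmod (phi \<alpha> (cpoint x y) (cpoint \<xi> 0)))" for \<xi>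
    define c where "c = kernel_mass \<alpha> y"
    have c: "0 < c" unfolding c_def using s by (intro kernel_mass_pos) auto
    have [measurable]: "P \<in> borel_measurable borel"
      unfolding P_def[abs_def] using phi_slice_measurable[OF s, of \<alpha> x] by measurable
    define A where "A = {\<xi> :: real ^ 'n. \<bar>\<xi> $ k - x $ k\<bar> < d}"
    have [measurable]: "A \<in> sets borel" unfolding A_def by measurable
    have P2: "(\<integral>\<^sup>+ \<xi>. P \<xi> ^ 2 \<partial>lborel) = ennreal (c * Q)"
      using nn_integral_phi_sq_UNIV[OF s, of \<alpha> x] by (simp add: P_def ennreal_power c_def Q_def)
    have PA: "(\<integral>\<^sup>+ \<xi>. (P \<xi> * indicator (- A) \<xi>) ^ 2 \<partial>lborel) \<le> ennreal (c * e2)"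
    proof -
      have "(\<integral>\<^sup>+ \<xi>. (P \<xi> * indicator (- A) \<xi>) ^ 2 \<partial>lborel) \<le>
          (\<integral>\<^sup>+ \<xi>. ennreal ((cmod (phi \<alpha> (cpoint x y) (cpoint \<xi> 0)))\<^sup>2) * indicator {\<xi>. r \<le> \<bar>(\<xi> $ k - x $ k) / (y + 0) $ k\<bar>} \<xi> \<partial>lborel)"
      proof (rule nn_integral_mono)
        fix \<xi> :: "real ^ 'n"
        have "r \<le> \<bar>(\<xi> $ k - x $ k) / (y + 0) $ k\<bar>" if "\<xi> \<notin> A"
        proof -
          have "r * y $ k < d" using y(2) r(1) by (simp add: field_simps)
          also have "d \<le> \<bar>\<xi> $ k - x $ k\<bar>" using that by (simp add: A_def)
          finally show ?thesis using s[of k] by (simp add: field_simps abs_divide)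
        qed
        then show "(P \<xi> * indicator (- A) \<xi>) ^ 2 \<le>
            ennreal ((cmod (phi \<alpha> (cpoint x y) (cpoint \<xi> 0)))\<^sup>2) * indicator {\<xi>. r \<le> \<bar>(\<xi> $ k - x $ k) / (y + 0) $ k\<bar>} \<xi>"
          by (cases "\<xi> \<in> A") (auto simp: P_def ennreal_power)
      qed
      also have "\<dots> \<le> ennreal c * ennreal e2"
        unfolding nn_integral_phi_sq[OF s] using r(2) by (simp add: c_def mult_left_mono)
      finally show ?thesis using c e12 by (simp add: ennreal_mult)
    qed
    have fA: "(\<integral>\<^sup>+ \<xi>. (ennreal (cmod (f \<xi>)) * indicator A \<xi>) ^ 2 \<partial>lborel) \<le> ennreal e1"
    proof -
      have "(ennreal (cmod (f \<xi>)) * indicator A \<xi>) ^ 2 = ennreal ((cmod (f \<xi>))\<^sup>2) * indicator A \<xi>" for \<xi>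
        by (auto simp: indicator_def ennreal_power)
      then show ?thesis using d(2)[of "x $ k"] by (simp add: A_def)
    qed
    have "(\<integral>\<^sup>+ \<xi>. ennreal (cmod (f \<xi>)) * P \<xi> \<partial>lborel) =
        (\<integral>\<^sup>+ \<xi>. ennreal (cmod (f \<xi>)) * indicator A \<xi> * P \<xi> + ennreal (cmod (f \<xi>)) * (P \<xi> * indicator (- A) \<xi>) \<partial>lborel)"
      by (intro nn_integral_cong) (auto simp: indicator_def)
    also have "\<dots> = (\<integral>\<^sup>+ \<xi>. ennreal (cmod (f \<xi>)) * indicator A \<xi> * P \<xi> \<partial>lborel) +
        (\<integral>\<^sup>+ \<xi>. ennreal (cmod (f \<xi>)) * (P \<xi> * indicator (- A) \<xi>) \<partial>lborel)"
      by (rule nn_integral_add) auto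
    finally have "(\<integral>\<^sup>+ \<xi>. ennreal (cmod (f \<xi>)) * P \<xi> \<partial>lborel)\<^sup>2 \<le>
        4 * ((\<integral>\<^sup>+ \<xi>. ennreal (cmod (f \<xi>)) * indicator A \<xi> * P \<xi> \<partial>lborel)\<^sup>2 +
          (\<integral>\<^sup>+ \<xi>. ennreal (cmod (f \<xi>)) * (P \<xi> * indicator (- A) \<xi>) \<partial>lborel)\<^sup>2)"
      by (simp only: ennreal_power2_add_le)
    also have "\<dots> \<le> 4 * (ennreal e1 * ennreal (c * Q) + ennreal N * ennreal (c * e2))"
    proof (intro mult_left_mono add_mono)
      have "(\<integral>\<^sup>+ \<xi>. ennreal (cmod (f \<xi>)) * indicator A \<xi> * P \<xi> \<partial>lborel)\<^sup>2 \<le>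
          (\<integral>\<^sup>+ \<xi>. (ennreal (cmod (f \<xi>)) * indicator A \<xi>) ^ 2 \<partial>lborel) * (\<integral>\<^sup>+ \<xi>. P \<xi> ^ 2 \<partial>lborel)"
        by (rule Cauchy_Schwarz_nn_integral) auto
      also have "\<dots> \<le> ennreal e1 * ennreal (c * Q)"
        unfolding P2 using fA by (rule mult_right_mono) simp
      finally show "(\<integral>\<^sup>+ \<xi>. ennreal (cmod (f \<xi>)) * indicator A \<xi> * P \<xi> \<partial>lborel)\<^sup>2 \<le> ennreal e1 * ennreal (c * Q)" .
      have "(\<integral>\<^sup>+ \<xi>. ennreal (cmod (f \<xi>)) * (P \<xi> * indicator (- A) \<xi>) \<partial>lborel)\<^sup>2 \<le>
          (\<integral>\<^sup>+ \<xi>. ennreal (cmod (f \<xi>)) ^ 2 \<partial>lborel) * (\<integral>\<^sup>+ \<xi>. (P \<xi> * indicator (- A) \<xi>) ^ 2 \<partial>lborel)"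
        by (rule Cauchy_Schwarz_nn_integral) auto
      also have "\<dots> \<le> ennreal N * ennreal (c * e2)"
        using PA by (simp add: ennreal_power N(1) mult_left_mono)
      finally show "(\<integral>\<^sup>+ \<xi>. ennreal (cmod (f \<xi>)) * (P \<xi> * indicator (- A) \<xi>) \<partial>lborel)\<^sup>2 \<le> ennreal N * ennreal (c * e2)" .
    qed simp
    also have "\<dots> = ennreal (4 * (e1 * (c * Q) + N * (c * e2)))"
      using c e12 Q N(2) by (simp add: ennreal_mult)
    also have "\<dots> \<le> ennreal (e * c)"
    proof (rule ennreal_leI)
      have "8 * (e1 * Q) \<le> e" "8 * (N * e2) \<le> e"
        using e Q N(2) by (simp_all add: e1_def e2_def field_simps)
      then have "c * (4 * (e1 * Q) + 4 * (N * e2)) \<le> c * e"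
        using c by (intro mult_left_mono) auto
      then show "4 * (e1 * (c * Q) + N * (c * e2)) \<le> e * c"
        by (simp add: algebra_simps)
    qed
    finally show "(\<integral>\<^sup>+ \<xi>. ennreal (cmod (f \<xi>)) * ennreal (cmod (phi \<alpha> (cpoint x y) (cpoint \<xi> 0))) \<partial>lborel)\<^sup>2
        \<le> ennreal (e * kernel_mass \<alpha> y)"
      unfolding P_def c_def .
  qed
qed

section \<open>Boundary value and norm of \<open>phi\<close>\<close>

lemma is_boundary_value_AE_unique:
  fixes G :: "complex ^ 'n \<Rightarrow> complex"
  assumes f: "is_boundary_value G f" and g: "is_boundary_value G g"
    and meas: "\<And>y. y \<in> Gamma1 \<Longrightarrow> (\<lambda>x. G (cpoint x y)) \<in> borel_measurable borel"
  shows "AE x in lborel. f x = g x"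
proof -
  define t :: "nat \<Rightarrow> real ^ 'n" where "t n = (\<chi> k. 1 / real (Suc n))" for n
  have t: "t n \<in> Gamma1" for n by (simp add: t_def Gamma1_def)
  have tlim: "filterlim t (at 0 within Gamma1) sequentially"
    unfolding t_def[abs_def] by (rule filterlim_Gamma1_zero)
  have [measurable]: "f \<in> borel_measurable lborel" "g \<in> borel_measurable lborel"
    "(\<lambda>x. G (cpoint x (t n))) \<in> borel_measurable lborel" for n
    using f g meas[OF t] by (simp_all add: is_boundary_value_def)
  have lim: "(\<lambda>n. \<integral>\<^sup>+ x. ennreal ((cmod (G (cpoint x (t n)) - h x))\<^sup>2) \<partial>lborel) \<longlonglongrightarrow> 0"
    if "is_boundary_value G h" for h
    using that by (intro filterlim_compose[OF _ tlim]) (simp add: is_boundary_value_def)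
  \<comment> \<open>This bounds the squared distance of \<open>f\<close> and \<open>g\<close>, which
    does not depend on \<open>n\<close>.\<close>
  have "(\<lambda>n. 2 * (\<integral>\<^sup>+ x. ennreal ((cmod (G (cpoint x (t n)) - f x))\<^sup>2) \<partial>lborel) +
      2 * (\<integral>\<^sup>+ x. ennreal ((cmod (G (cpoint x (t n)) - g x))\<^sup>2) \<partial>lborel)) \<longlonglongrightarrow> 2 * 0 + 2 * 0"
    by (intro tendsto_add ennreal_tendsto_cmult lim f g) auto
  moreover have "(\<integral>\<^sup>+ x. ennreal ((cmod (f x - g x))\<^sup>2) \<partial>lborel) \<le>
      2 * (\<integral>\<^sup>+ x. ennreal ((cmod (G (cpoint x (t n)) - f x))\<^sup>2) \<partial>lborel) +
      2 * (\<integral>\<^sup>+ x. ennreal ((cmod (G (cpoint x (t n)) - g x))\<^sup>2) \<partial>lborel)" for n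
    using nn_integral_sqnorm_triangle[of f lborel "\<lambda>x. G (cpoint x (t n))" g]
    by (simp add: norm_minus_commute)
  ultimately have "(\<integral>\<^sup>+ x. ennreal ((cmod (f x - g x))\<^sup>2) \<partial>lborel) \<le> 2 * 0 + 2 * 0"
    by (metis (no_types, lifting) LIMSEQ_le_const)
  then have "(\<integral>\<^sup>+ x. ennreal ((cmod (f x - g x))\<^sup>2) \<partial>lborel) = 0" by simp
  then have "AE x in lborel. ennreal ((cmod (f x - g x))\<^sup>2) = 0"
    by (subst (asm) nn_integral_0_iff_AE) auto
  then show ?thesis
    by eventually_elim (simp add: ennreal_eq_0_iff)
qed

text \<open>Raising the slice increases the modulus of every denominator. This makes the boundary
  slice a majorant for dominated convergence.\<close>

lemma cmod_phi_le:
  fixes x y \<xi> y' :: "real ^ 'n"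
  assumes "y \<in> Gamma1" "y' \<in> Gamma1"
  shows "cmod (phi \<alpha> (cpoint x y) (cpoint \<xi> y')) \<le> cmod (phi \<alpha> (cpoint x y) (cpoint \<xi> 0))"
proof -
  have pos: "0 < y $ j" "0 < y' $ j" for j using assms by (auto simp: Gamma1_def)
  have "fact (\<alpha> $ j) / cmod (Complex (\<xi> $ j - x $ j) (y $ j + y' $ j)) ^ (\<alpha> $ j + 1) \<le>
      fact (\<alpha> $ j) / cmod (Complex (\<xi> $ j - x $ j) (y $ j + 0 $ j)) ^ (\<alpha> $ j + 1)" for j
  proof (rule divide_left_mono)
    have le: "cmod (Complex (\<xi> $ j - x $ j) (y $ j + 0 $ j)) \<le> cmod (Complex (\<xi> $ j - x $ j) (y $ j + y' $ j))"
      using pos[of j] by (simp add: cmod_def power_mono)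
    then show "cmod (Complex (\<xi> $ j - x $ j) (y $ j + 0 $ j)) ^ (\<alpha> $ j + 1) \<le>
        cmod (Complex (\<xi> $ j - x $ j) (y $ j + y' $ j)) ^ (\<alpha> $ j + 1)"
      by (intro power_mono) auto
    have "0 < cmod (Complex (\<xi> $ j - x $ j) (y $ j + 0 $ j))"
      using pos[of j] by (simp add: complex_eq_iff)
    then show "0 < cmod (Complex (\<xi> $ j - x $ j) (y $ j + y' $ j)) ^ (\<alpha> $ j + 1) *
        cmod (Complex (\<xi> $ j - x $ j) (y $ j + 0 $ j)) ^ (\<alpha> $ j + 1)"
      using le by (intro mult_pos_pos zero_less_power) auto
  qed simp
  then show ?thesis
    using pos by (subst (1 2) phi_cpoint)
      (auto simp: norm_mult norm_power norm_divide prod_norm[symmetric] add_pos_pos intro!: mult_left_mono prod_mono simp del: power_Suc)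
qed

text \<open>The singularities of \<open>phi\<close> lie at heights with some coordinate
  \<open>- y $ j\<close>, so \<open>phi\<close> is continuous up to height 0. Dominated convergence
  is applied along arbitrary sequences of heights; the majorant has factor 4 because the difference
  of two slices is at most twice the boundary slice.\<close>

lemma phi_boundary_value:
  fixes x y :: "real ^ 'n"
  assumes y: "y \<in> Gamma1"
  shows "is_boundary_value (phi \<alpha> (cpoint x y)) (\<lambda>\<xi>. phi \<alpha> (cpoint x y) (cpoint \<xi> 0))"
proof -
  let ?G = "phi \<alpha> (cpoint x y)"
  have pos: "0 < y $ j" for j using y by (simp add: Gamma1_def)
  have s: "0 < (y + 0) $ j" for j using pos by simp
  have m0 [measurable]: "(\<lambda>\<xi>. ?G (cpoint \<xi> 0)) \<in> borel_measurable borel"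
    by (rule phi_slice_measurable[OF s])
  have m: "(\<lambda>\<xi>. ?G (cpoint \<xi> y')) \<in> borel_measurable borel" if "y' \<in> Gamma1" for y'
    using pos that by (intro phi_slice_measurable) (auto simp: Gamma1_def intro: add_pos_pos)
  have fin: "(\<integral>\<^sup>+ \<xi>. ennreal ((cmod (?G (cpoint \<xi> 0)))\<^sup>2) \<partial>lborel) < \<infinity>"
    unfolding nn_integral_phi_sq_UNIV[OF s] by simp
  have "((\<lambda>y'. \<integral>\<^sup>+ \<xi>. ennreal ((cmod (?G (cpoint \<xi> y') - ?G (cpoint \<xi> 0)))\<^sup>2) \<partial>lborel) \<longlongrightarrow> 0) (at 0 within Gamma1)"
    unfolding tendsto_at_iff_sequentially
  proof (intro allI impI)
    fix X :: "nat \<Rightarrow> real ^ 'n"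
    assume X: "\<forall>i. X i \<in> Gamma1 - {0}" "X \<longlonglongrightarrow> 0"
    have [measurable]: "(\<lambda>\<xi>. ?G (cpoint \<xi> (X n))) \<in> borel_measurable borel" for n
      using m X(1) by simp
    have "(\<lambda>n. \<integral>\<^sup>+ \<xi>. ennreal ((cmod (?G (cpoint \<xi> (X n)) - ?G (cpoint \<xi> 0)))\<^sup>2) \<partial>lborel) \<longlonglongrightarrow>
        (\<integral>\<^sup>+ \<xi>. 0 \<partial>(lborel :: (real ^ 'n) measure))"
    proof (rule nn_integral_dominated_convergence[where w = "\<lambda>\<xi>. 4 * ennreal ((cmod (?G (cpoint \<xi> 0)))\<^sup>2)"])
      show "AE \<xi> in lborel. ennreal ((cmod (?G (cpoint \<xi> (X n)) - ?G (cpoint \<xi> 0)))\<^sup>2) \<le> 4 * ennreal ((cmod (?G (cpoint \<xi> 0)))\<^sup>2)" for n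
      proof (rule AE_I2)
        fix \<xi> :: "real ^ 'n"
        have "cmod (?G (cpoint \<xi> (X n)) - ?G (cpoint \<xi> 0)) \<le> 2 * cmod (?G (cpoint \<xi> 0))"
          using norm_triangle_ineq4[of "?G (cpoint \<xi> (X n))" "?G (cpoint \<xi> 0)"] cmod_phi_le[OF y, of "X n" \<alpha> x \<xi>] X(1) by simp
        then have "(cmod (?G (cpoint \<xi> (X n)) - ?G (cpoint \<xi> 0)))\<^sup>2 \<le> (2 * cmod (?G (cpoint \<xi> 0)))\<^sup>2"
          by (intro power_mono) auto
        then have "ennreal ((cmod (?G (cpoint \<xi> (X n)) - ?G (cpoint \<xi> 0)))\<^sup>2) \<le> ennreal (4 * (cmod (?G (cpoint \<xi> 0)))\<^sup>2)"
          by (intro ennreal_leI) (simp add: power_mult_distrib)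
        then show "ennreal ((cmod (?G (cpoint \<xi> (X n)) - ?G (cpoint \<xi> 0)))\<^sup>2) \<le> 4 * ennreal ((cmod (?G (cpoint \<xi> 0)))\<^sup>2)"
          by (simp add: ennreal_mult)
      qed
      show "(\<integral>\<^sup>+ \<xi>. 4 * ennreal ((cmod (?G (cpoint \<xi> 0)))\<^sup>2) \<partial>lborel) < \<infinity>"
        using fin by (simp add: nn_integral_cmult ennreal_mult_less_top)
      show "AE \<xi> in lborel. (\<lambda>n. ennreal ((cmod (?G (cpoint \<xi> (X n)) - ?G (cpoint \<xi> 0)))\<^sup>2)) \<longlonglongrightarrow> 0"
      proof (rule AE_I2)
        fix \<xi> :: "real ^ 'n"
        have "continuous_on (insert 0 Gamma1) (\<lambda>y'. ?G (cpoint \<xi> y'))"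
          by (intro continuous_on_phi_cpoint continuous_intros) (auto simp: Gamma1_def pos intro: add_pos_pos)
        then have "(\<lambda>n. ?G (cpoint \<xi> (X n))) \<longlonglongrightarrow> ?G (cpoint \<xi> 0)"
          by (rule continuous_on_tendsto_compose[OF _ X(2)]) (use X(1) in auto)
        then have "(\<lambda>n. ennreal ((cmod (?G (cpoint \<xi> (X n)) - ?G (cpoint \<xi> 0)))\<^sup>2)) \<longlonglongrightarrow>
            ennreal ((cmod (?G (cpoint \<xi> 0) - ?G (cpoint \<xi> 0)))\<^sup>2)"
          by (intro tendsto_ennrealI tendsto_intros)
        then show "(\<lambda>n. ennreal ((cmod (?G (cpoint \<xi> (X n)) - ?G (cpoint \<xi> 0)))\<^sup>2)) \<longlonglongrightarrow> 0" by simp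
      qed
    qed auto
    then show "((\<lambda>y'. \<integral>\<^sup>+ \<xi>. ennreal ((cmod (?G (cpoint \<xi> y') - ?G (cpoint \<xi> 0)))\<^sup>2) \<partial>lborel) \<circ> X) \<longlonglongrightarrow> 0"
      by (simp add: o_def)
  qed
  then show ?thesis
    unfolding is_boundary_value_def using fin m0 by simp
qed

lemma is_boundary_value_boundary_value:
  "is_boundary_value F f \<Longrightarrow> is_boundary_value F (boundary_value F)"
  unfolding boundary_value_def by (rule someI[of "is_boundary_value F"])

text \<open>The supremum defining the norm is bounded below by its value on the slice \<open>y' = y\<close>, at the
  price of a constant factor depending only on \<open>\<alpha>\<close>.\<close>

lemma hardy_norm_phi_ge:
  fixes x y :: "real ^ 'n"
  assumes y: "y \<in> Gamma1"
  shows "(\<Prod>j\<in>UNIV. (1/2) ^ (2 * \<alpha> $ j + 1)) * kernel_mass \<alpha> y * profile_mass \<alpha> \<le> (hardy_norm (phi \<alpha> (cpoint x y)))\<^sup>2"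
proof -
  have pos: "0 < y $ j" for j using y by (simp add: Gamma1_def)
  have I: "(\<integral>\<^sup>+ \<xi>. ennreal ((cmod (phi \<alpha> (cpoint x y) (cpoint \<xi> y')))\<^sup>2) \<partial>lborel) =
      ennreal (kernel_mass \<alpha> (y + y') * profile_mass \<alpha>)" if "y' \<in> Gamma1" for y'
    using that pos by (intro nn_integral_phi_sq_UNIV) (auto simp: Gamma1_def intro: add_pos_pos)
  \<comment> \<open>Finiteness has to come first: \<open>enn2real\<close> sends infinity to 0, so a
    lower bound in \<open>ennreal\<close> would not survive the passage to reals otherwise.\<close>
  have "hardy_sqnorm (phi \<alpha> (cpoint x y)) \<le> ennreal (kernel_mass \<alpha> y * profile_mass \<alpha>)"
    unfolding hardy_sqnorm_def
  proof (rule SUP_least)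
    fix y' :: "real ^ 'n" assume y': "y' \<in> Gamma1"
    have "kernel_mass \<alpha> (y + y') \<le> kernel_mass \<alpha> y"
      using pos y' by (intro kernel_mass_antimono) (auto simp: Gamma1_def less_imp_le)
    then show "(\<integral>\<^sup>+ \<xi>. ennreal ((cmod (phi \<alpha> (cpoint x y) (cpoint \<xi> y')))\<^sup>2) \<partial>lborel) \<le> ennreal (kernel_mass \<alpha> y * profile_mass \<alpha>)"
      unfolding I[OF y'] using profile_mass_pos[of \<alpha>] by (intro ennreal_leI mult_right_mono) auto
  qed
  then have fin: "hardy_sqnorm (phi \<alpha> (cpoint x y)) < \<infinity>"
    by (rule le_less_trans) simp
  have "ennreal (kernel_mass \<alpha> (y + y) * profile_mass \<alpha>) \<le> hardy_sqnorm (phi \<alpha> (cpoint x y))"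
    unfolding hardy_sqnorm_def I[OF y, symmetric] by (rule SUP_upper[OF y])
  then have "kernel_mass \<alpha> (y + y) * profile_mass \<alpha> \<le> enn2real (hardy_sqnorm (phi \<alpha> (cpoint x y)))"
    using fin by (metis enn2real_mono enn2real_nonneg enn2real_ennreal ennreal_eq_0_iff infinity_ennreal_def nle_le order_trans)
  then show ?thesis
    by (simp only: hardy_norm_def real_sqrt_pow2 enn2real_nonneg kernel_mass_double)
qed

section \<open>The uniform limit at a frontier point of the cone\<close>

theorem lemma4p3:
  fixes F :: "complex ^ 'n \<Rightarrow> complex"
    and \<alpha> :: "nat ^ 'n"
    and \<beta> :: "real ^ 'n"
  assumes "F \<in> hardy_space"
    and "\<beta> \<in> frontier Gamma1"
  shows "uniform_limit UNIV
    (\<lambda>y x. cmod (hardy_inner F (phi \<alpha> (cpoint x y))) / hardy_norm (phi \<alpha> (cpoint x y)))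
    (\<lambda>x. 0) (at \<beta> within Gamma1)"
proof (rule uniform_limitI)
  fix e :: real assume e: "0 < e"
  define f where "f = boundary_value F"
  have f: "is_boundary_value F f"
    using hardy_boundary_value_exists[OF assms(1)] is_boundary_value_boundary_value unfolding f_def by blast
  then have f_meas [measurable]: "f \<in> borel_measurable borel"
    and f_fin: "(\<integral>\<^sup>+ x. ennreal ((cmod (f x))\<^sup>2) \<partial>lborel) < \<infinity>"
    by (auto simp: is_boundary_value_def)
  \<comment> \<open>\<open>Gamma1\<close> is open, so it misses its frontier; the resulting
    coordinate \<open>\<beta> $ k \<le> 0\<close> forces \<open>y $ k\<close> below any positive
    \<open>\<eta>\<close> near \<open>\<beta>\<close>.\<close>
  have "\<beta> \<notin> Gamma1"
    using assms(2) by (simp add: frontier_def interior_open[OF open_Gamma1])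
  then obtain k where k: "\<beta> $ k \<le> 0"
    by (auto simp: Gamma1_def not_less)
  \<comment> \<open>\<open>\<kappa> * kernel_mass \<alpha> y\<close> is the lower bound of
    \<open>hardy_norm_phi_ge\<close> for the squared norm of \<open>phi\<close>; halving in
    \<open>e'\<close> below makes the final estimate strict.\<close>
  define \<kappa> where "\<kappa> = (\<Prod>j\<in>UNIV. (1/2) ^ (2 * \<alpha> $ j + 1)) * profile_mass \<alpha>"
  have \<kappa>: "0 < \<kappa>"
    unfolding \<kappa>_def by (intro mult_pos_pos prod_pos profile_mass_pos) simp
  define e' where "e' = \<kappa> * e\<^sup>2 / 2"
  have e': "0 < e'" "e' < \<kappa> * e\<^sup>2" using \<kappa> e by (simp_all add: e'_def)
  obtain \<eta> where \<eta>: "0 < \<eta>"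
    "\<And>x y. \<lbrakk>y \<in> Gamma1; y $ k < \<eta>\<rbrakk> \<Longrightarrow>
      (\<integral>\<^sup>+ \<xi>. ennreal (cmod (f \<xi>)) * ennreal (cmod (phi \<alpha> (cpoint x y) (cpoint \<xi> 0))) \<partial>lborel)\<^sup>2
        \<le> ennreal (e' * kernel_mass \<alpha> y)"
    by (rule pairing_phi_small[OF f_meas f_fin e'(1)]) blast
  have bound: "cmod (hardy_inner F (phi \<alpha> (cpoint x y))) / hardy_norm (phi \<alpha> (cpoint x y)) < e"
    if y: "y \<in> Gamma1" "y $ k < \<eta>" for x y
  proof -
    define G where "G = phi \<alpha> (cpoint x y)"
    define c where "c = kernel_mass \<alpha> y"
    have c: "0 < c" unfolding c_def using y(1) by (intro kernel_mass_pos) (auto simp: Gamma1_def)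
    have bvG: "is_boundary_value G (\<lambda>\<xi>. G (cpoint \<xi> 0))"
      unfolding G_def by (rule phi_boundary_value[OF y(1)])
    have "(\<lambda>\<xi>. G (cpoint \<xi> y')) \<in> borel_measurable borel" if "y' \<in> Gamma1" for y'
      unfolding G_def using y(1) that by (intro phi_slice_measurable) (auto simp: Gamma1_def intro: add_pos_pos)
    \<comment> \<open>\<open>boundary_value\<close> is an arbitrary choice of representative; almost
      everywhere it agrees with the explicit slice at height 0, which is enough under the
      integral.\<close>
    then have AE: "AE \<xi> in lborel. boundary_value G \<xi> = G (cpoint \<xi> 0)"
      by (intro is_boundary_value_AE_unique[OF is_boundary_value_boundary_value[OF bvG] bvG])
    have "ennreal (cmod (hardy_inner F G)) \<le> (\<integral>\<^sup>+ \<xi>. ennreal (cmod (f \<xi> * cnj (boundary_value G \<xi>))) \<partial>lborel)"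
    proof (cases "integrable lborel (\<lambda>\<xi>. f \<xi> * cnj (boundary_value G \<xi>))")
      case True
      then show ?thesis
        unfolding hardy_inner_def f_def by (rule integral_norm_bound_ennreal)
    next
      \<comment> \<open>The Bochner integral of a non-integrable function is 0 by convention, so the
        bound holds trivially.\<close>
      case False
      then show ?thesis
        unfolding hardy_inner_def f_def by (simp add: not_integrable_integral_eq)
    qed
    also have "\<dots> = (\<integral>\<^sup>+ \<xi>. ennreal (cmod (f \<xi>)) * ennreal (cmod (G (cpoint \<xi> 0))) \<partial>lborel)"
      by (rule nn_integral_cong_AE) (use AE in \<open>auto elim!: eventually_mono simp: norm_mult ennreal_mult\<close>)
    finally have "(ennreal (cmod (hardy_inner F G)))\<^sup>2 \<le>
        (\<integral>\<^sup>+ \<xi>. ennreal (cmod (f \<xi>)) * ennreal (cmod (G (cpoint \<xi> 0))) \<partial>lborel)\<^sup>2"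
      by (rule power_mono) simp
    also have "\<dots> \<le> ennreal (e' * c)"
      unfolding G_def c_def by (rule \<eta>(2)[OF y])
    finally have "(cmod (hardy_inner F G))\<^sup>2 \<le> e' * c"
      using e' c by (simp add: ennreal_power)
    also have "\<dots> < (\<kappa> * e\<^sup>2) * c"
      using e' c by simp
    also have "\<dots> = e\<^sup>2 * (\<kappa> * c)" by simp
    also have "\<dots> \<le> e\<^sup>2 * (hardy_norm G)\<^sup>2"
      using hardy_norm_phi_ge[OF y(1), of \<alpha> x] by (intro mult_left_mono) (auto simp: \<kappa>_def c_def G_def mult_ac)
    finally have "(cmod (hardy_inner F G))\<^sup>2 < (e * hardy_norm G)\<^sup>2"
      by (simp add: power_mult_distrib)
    moreover have "0 \<le> e * hardy_norm G" using e by (simp add: hardy_norm_def)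
    ultimately have lt: "cmod (hardy_inner F G) < e * hardy_norm G"
      by (rule power2_less_imp_less)
    \<comment> \<open>The strict inequality itself shows that the norm of \<open>phi\<close> is
      positive, which licenses the division.\<close>
    then have "0 < e * hardy_norm G" by (rule le_less_trans[rotated]) simp
    then have "0 < hardy_norm G" using e by (simp add: zero_less_mult_iff)
    then show ?thesis
      using lt by (simp add: G_def divide_less_eq)
  qed
  have "((\<lambda>y. y $ k) \<longlongrightarrow> \<beta> $ k) (at \<beta> within Gamma1)"
    by (intro tendsto_intros)
  from order_tendstoD(2)[OF this, of \<eta>]
  have "\<forall>\<^sub>F y in at \<beta> within Gamma1. y $ k < \<eta>"
    using k \<eta>(1) by simp
  moreover have "\<forall>\<^sub>F y in at \<beta> within Gamma1. y \<in> Gamma1"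
    by (simp add: eventually_at_filter)
  ultimately show "\<forall>\<^sub>F y in at \<beta> within Gamma1. \<forall>x\<in>UNIV.
      dist (cmod (hardy_inner F (phi \<alpha> (cpoint x y))) / hardy_norm (phi \<alpha> (cpoint x y))) 0 < e"
  proof eventually_elim
    case (elim y)
    then show ?case
      using bound by (auto simp: dist_real_def hardy_norm_def)
  qed
qed

end
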